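(* Let $G$ be a connected, infinite, locally finite $L_1$-graph such that $|N(u)\cap N(v)|\ge 2$ for each pair of vertices $u,v$ with $d(u,v)=2$. Then the Freudenthal compactification $|G|$ of $G$ has a Hamilton curve.
   Context: All graphs are simple. $N(u)$ denotes the neighborhood of $u$, $d(u)=|N(u)|$, and $d(u,v)$ the distance. A graph is locally finite if every vertex has finite degree. A graph $G$ is an $L_1$-graph if $d(u)+d(v)\ge |N(u)\cup N(v)\cup N(w)|-1$ for every triple of vertices $u,v,w$ with $d(u,v)=2$ and $w\in N(u)\cap N(v)$. A ray is a one-way infinite path; two rays are equivalent if for every finite vertex set $S$ they have subrays in the same component of $G-S$; the equivalence classes are the ends of $G$. The Freudenthal compactification $|G|$ is the topological space obtained by viewing $G$ as a 1-complex and adding its ends as points (with the standard topology in which a basic neighborhood of an end $\omega$ consists of the component of $G-S$ containing a tail of $\omega$'s rays, for finite $S$, together with the ends living there and partial edges). A Hamilton curve in $|G|$ is a closed curve (continuous image of the unit circle) in $|G|$ that meets every vertex of $G$ exactly once (it may meet ends multiple times). *)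

theory Defs
  imports "HOL-Analysis.Analysis" "HOL-Library.Extended_Nat"
begin

section \<open>Simple graphs\<close>

definition simple_graph :: "'a set \<Rightarrow> 'a set set \<Rightarrow> bool" where
  "simple_graph V E \<longleftrightarrow> (\<forall>e\<in>E. \<exists>u\<in>V. \<exists>v\<in>V. u \<noteq> v \<and> e = {u, v})"

definition nbhd :: "'a set set \<Rightarrow> 'a \<Rightarrow> 'a set" where
  "nbhd E u = {v. {u, v} \<in> E}"

text \<open>Only meaningful for vertices of finite degree, since \<open>card\<close> of an infinite set is 0.\<close>

definition degree :: "'a set set \<Rightarrow> 'a \<Rightarrow> nat" where
  "degree E u = card (nbhd E u)"

definition locally_finite_graph :: "'a set \<Rightarrow> 'a set set \<Rightarrow> bool" where
  "locally_finite_graph V E \<longleftrightarrow> (\<forall>v\<in>V. finite (nbhd E v))"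

text \<open>Adjacency in the subgraph induced on \<open>X\<close>; its iterates describe walks in that subgraph.\<close>

definition adj_on :: "'a set set \<Rightarrow> 'a set \<Rightarrow> ('a \<times> 'a) set" where
  "adj_on E X = {(x, y). x \<in> X \<and> y \<in> X \<and> {x, y} \<in> E}"

definition connected_graph :: "'a set \<Rightarrow> 'a set set \<Rightarrow> bool" where
  "connected_graph V E \<longleftrightarrow> (\<forall>u\<in>V. \<forall>v\<in>V. (u, v) \<in> (adj_on E V)\<^sup>*)"

text \<open>Infinite (the infimum of the empty set) if no walk joins the two vertices.\<close>

definition gdist :: "'a set \<Rightarrow> 'a set set \<Rightarrow> 'a \<Rightarrow> 'a \<Rightarrow> enat" where
  "gdist V E u v = (INF n \<in> {n. (u, v) \<in> adj_on E V ^^ n}. enat n)"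

text \<open>The inequality is stated over the integers to avoid truncated subtraction.\<close>

definition L1_graph :: "'a set \<Rightarrow> 'a set set \<Rightarrow> bool" where
  "L1_graph V E \<longleftrightarrow> simple_graph V E \<and>
     (\<forall>u\<in>V. \<forall>v\<in>V. \<forall>w\<in>V. gdist V E u v = 2 \<and> w \<in> nbhd E u \<inter> nbhd E v \<longrightarrow>
        int (degree E u) + int (degree E v)
          \<ge> int (card (nbhd E u \<union> nbhd E v \<union> nbhd E w)) - 1)"


section \<open>Ends\<close>

definition reach_on :: "'a set set \<Rightarrow> 'a set \<Rightarrow> ('a \<times> 'a) set" where
  "reach_on E X = (adj_on E X)\<^sup>* \<inter> X \<times> X"

text \<open>Vertex sets of the components of the subgraph induced on \<open>X\<close>; \<open>G - S\<close> is the case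
  \<open>X = V - S\<close>.\<close>

definition graph_components :: "'a set set \<Rightarrow> 'a set \<Rightarrow> 'a set set" where
  "graph_components E X = X // reach_on E X"

definition ray :: "'a set \<Rightarrow> 'a set set \<Rightarrow> (nat \<Rightarrow> 'a) \<Rightarrow> bool" where
  "ray V E r \<longleftrightarrow> range r \<subseteq> V \<and> inj r \<and> (\<forall>n. {r n, r (Suc n)} \<in> E)"

definition has_tail_in :: "(nat \<Rightarrow> 'a) \<Rightarrow> 'a set \<Rightarrow> bool" where
  "has_tail_in r C \<longleftrightarrow> (\<exists>n. r ` {n..} \<subseteq> C)"

definition ray_equiv :: "'a set \<Rightarrow> 'a set set \<Rightarrow> ((nat \<Rightarrow> 'a) \<times> (nat \<Rightarrow> 'a)) set" where
  "ray_equiv V E = {(r, r'). ray V E r \<and> ray V E r' \<and>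
     (\<forall>S. finite S \<and> S \<subseteq> V \<longrightarrow>
        (\<exists>C \<in> graph_components E (V - S). has_tail_in r C \<and> has_tail_in r' C))}"

definition ends :: "'a set \<Rightarrow> 'a set set \<Rightarrow> (nat \<Rightarrow> 'a) set set" where
  "ends V E = {r. ray V E r} // ray_equiv V E"

definition lives_in :: "(nat \<Rightarrow> 'a) set \<Rightarrow> 'a set \<Rightarrow> bool" where
  "lives_in \<omega> C \<longleftrightarrow> (\<forall>r\<in>\<omega>. has_tail_in r C)"


section \<open>The Freudenthal compactification\<close>

text \<open>A point of the 1-complex is given by its barycentric coordinates. For an edge \<open>{u, v}\<close>,
  the point \<open>edge_point u v t\<close> lies at distance \<open>t\<close> from \<open>u\<close> and \<open>1 - t\<close> from \<open>v\<close>, so it is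
  the same point as \<open>edge_point v u (1 - t)\<close>; edges need no orientation.\<close>

datatype 'a fpoint = Pt "'a \<Rightarrow> real" | End "(nat \<Rightarrow> 'a) set"

definition vertex_point :: "'a \<Rightarrow> 'a fpoint" where
  "vertex_point v = Pt (\<lambda>x. if x = v then 1 else 0)"

definition edge_point :: "'a \<Rightarrow> 'a \<Rightarrow> real \<Rightarrow> 'a fpoint" where
  "edge_point u v t = Pt (\<lambda>x. if x = u then 1 - t else if x = v then t else 0)"

definition freudenthal_points :: "'a set \<Rightarrow> 'a set set \<Rightarrow> 'a fpoint set" where
  "freudenthal_points V E = vertex_point ` V
     \<union> {edge_point u v t | u v t. {u, v} \<in> E \<and> 0 < t \<and> t < 1}
     \<union> End ` ends V E"

definition vertex_star :: "'a set set \<Rightarrow> 'a \<Rightarrow> real \<Rightarrow> 'a fpoint set" where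
  "vertex_star E v \<epsilon> =
     insert (vertex_point v) {edge_point v w t | w t. {v, w} \<in> E \<and> 0 < t \<and> t < \<epsilon>}"

definition edge_interval :: "'a \<Rightarrow> 'a \<Rightarrow> real \<Rightarrow> real \<Rightarrow> 'a fpoint set" where
  "edge_interval u v a b = {edge_point u v t | t. a < t \<and> t < b}"

text \<open>For a component \<open>C\<close> of \<open>G - S\<close>: the 1-complex of \<open>G[C]\<close>, the parts of length \<open>\<epsilon>\<close> at \<open>C\<close> of
  the edges between \<open>C\<close> and \<open>S\<close>, and the ends living in \<open>C\<close>.\<close>

definition end_nbhd ::
  "'a set \<Rightarrow> 'a set set \<Rightarrow> 'a set \<Rightarrow> 'a set \<Rightarrow> real \<Rightarrow> 'a fpoint set" where
  "end_nbhd V E S C \<epsilon> = vertex_point ` C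
     \<union> {edge_point u v t | u v t. u \<in> C \<and> v \<in> C \<and> {u, v} \<in> E \<and> 0 < t \<and> t < 1}
     \<union> {edge_point c s t | c s t. c \<in> C \<and> s \<in> S \<and> {c, s} \<in> E \<and> 0 < t \<and> t < \<epsilon>}
     \<union> End ` {\<omega> \<in> ends V E. lives_in \<omega> C}"

text \<open>Vertex neighbourhoods use one radius \<open>\<epsilon>\<close> for all incident edges. For locally finite graphs
  this gives the topology of the 1-complex.\<close>

definition freudenthal_basis :: "'a set \<Rightarrow> 'a set set \<Rightarrow> 'a fpoint set set" where
  "freudenthal_basis V E =
     {vertex_star E v \<epsilon> | v \<epsilon>. v \<in> V \<and> 0 < \<epsilon> \<and> \<epsilon> \<le> 1}
     \<union> {edge_interval u v a b | u v a b. {u, v} \<in> E \<and> 0 \<le> a \<and> a < b \<and> b \<le> 1}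
     \<union> {end_nbhd V E S C \<epsilon> | S C \<omega> \<epsilon>. finite S \<and> S \<subseteq> V \<and> C \<in> graph_components E (V - S)
          \<and> \<omega> \<in> ends V E \<and> lives_in \<omega> C \<and> 0 < \<epsilon> \<and> \<epsilon> \<le> 1}"

definition freudenthal :: "'a set \<Rightarrow> 'a set set \<Rightarrow> 'a fpoint topology" where
  "freudenthal V E = topology_generated_by (freudenthal_basis V E)"

definition hamilton_curve :: "'a set \<Rightarrow> 'a set set \<Rightarrow> (complex \<Rightarrow> 'a fpoint) \<Rightarrow> bool" where
  "hamilton_curve V E f \<longleftrightarrow>
     continuous_map (top_of_set (sphere 0 1)) (freudenthal V E) f \<and>
     (\<forall>v\<in>V. \<exists>!z. z \<in> sphere 0 1 \<and> f z = vertex_point v)"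


section \<open>Basic facts\<close>

lemma edge_point_commute: "u \<noteq> v \<Longrightarrow> edge_point u v t = edge_point v u (1 - t)"
  by (auto simp: edge_point_def fun_eq_iff)

lemma sym_adj_on: "sym (adj_on E X)"
  by (auto simp: sym_def adj_on_def insert_commute)

lemma equiv_reach_on: "equiv X (reach_on E X)"
proof (rule equivI)
  show "refl_on X (reach_on E X)"
    by (auto simp: refl_on_def reach_on_def)
  show "sym (reach_on E X)"
    using sym_rtrancl[OF sym_adj_on[of E X]] by (auto simp: sym_def reach_on_def)
  show "trans (reach_on E X)"
    by (auto simp: trans_def reach_on_def)
qed (auto simp: reach_on_def)

lemma has_tail_in_component_unique:
  assumes "C \<in> graph_components E X" "D \<in> graph_components E X"
    and "has_tail_in r C" "has_tail_in r D"
  shows "C = D"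
proof -
  obtain m n where "r ` {m..} \<subseteq> C" "r ` {n..} \<subseteq> D"
    using assms by (auto simp: has_tail_in_def)
  then have "r (max m n) \<in> C \<inter> D" by auto
  then show ?thesis
    using quotient_disj[OF equiv_reach_on] assms(1,2) unfolding graph_components_def by blast
qed

lemma ray_has_tail_in_component:
  assumes "ray V E r" "finite S"
  shows "\<exists>C \<in> graph_components E (V - S). has_tail_in r C"
proof -
  have "finite {n. r n \<in> S}"
    using assms finite_vimageI[of S r] by (simp add: ray_def vimage_def)
  then obtain m where "\<forall>n\<in>{n. r n \<in> S}. n < m"
    using finite_nat_set_iff_bounded by blast
  then have m: "r n \<in> V - S" if "n \<ge> m" for n
    using that assms(1) by (force simp: ray_def)
  have "(r m, r (m + k)) \<in> (adj_on E (V - S))\<^sup>*" for k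
  proof (induction k)
    case (Suc k)
    have "(r (m + k), r (Suc (m + k))) \<in> adj_on E (V - S)"
      using m[of "m + k"] m[of "Suc (m + k)"] assms(1) by (simp add: adj_on_def ray_def)
    with Suc show ?case by (auto intro: rtrancl.rtrancl_into_rtrancl)
  qed simp
  then have "(r m, r n) \<in> reach_on E (V - S)" if "n \<ge> m" for n
    using that m[of n] m[of m] by (metis IntI SigmaI le_add_diff_inverse order_refl reach_on_def)
  then have "has_tail_in r (reach_on E (V - S) `` {r m})"
    by (auto simp: has_tail_in_def)
  then show ?thesis
    using m[of m] by (auto simp: graph_components_def intro: quotientI)
qed

lemma equiv_ray_equiv: "equiv {r. ray V E r} (ray_equiv V E)"
proof (rule equivI)
  show "refl_on {r. ray V E r} (ray_equiv V E)"
    using ray_has_tail_in_component by (auto simp: refl_on_def ray_equiv_def)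
  show "sym (ray_equiv V E)"
    unfolding sym_def ray_equiv_def by blast
  show "trans (ray_equiv V E)"
  proof (rule transI)
    fix p q r assume pq: "(p, q) \<in> ray_equiv V E" and qr: "(q, r) \<in> ray_equiv V E"
    have "\<exists>C \<in> graph_components E (V - S). has_tail_in p C \<and> has_tail_in r C"
      if S: "finite S" "S \<subseteq> V" for S
    proof -
      obtain C where C: "C \<in> graph_components E (V - S)" "has_tail_in p C" "has_tail_in q C"
        using pq S by (auto simp: ray_equiv_def)
      obtain D where D: "D \<in> graph_components E (V - S)" "has_tail_in q D" "has_tail_in r D"
        using qr S by (auto simp: ray_equiv_def)
      have "C = D" using has_tail_in_component_unique[OF C(1) D(1) C(3) D(2)] .
      with C D show ?thesis by auto
    qed
    then show "(p, r) \<in> ray_equiv V E"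
      using pq qr by (auto simp: ray_equiv_def)
  qed
qed (auto simp: ray_equiv_def)

lemma end_lives_in_component:
  assumes "\<omega> \<in> ends V E" "finite S" "S \<subseteq> V"
  shows "\<exists>!C. C \<in> graph_components E (V - S) \<and> lives_in \<omega> C"
proof -
  obtain r where r: "ray V E r" "\<omega> = ray_equiv V E `` {r}"
    using assms(1) by (auto simp: ends_def elim: quotientE)
  obtain C where C: "C \<in> graph_components E (V - S)" "has_tail_in r C"
    using ray_has_tail_in_component[OF r(1) assms(2)] by blast
  have "has_tail_in r' C" if "r' \<in> \<omega>" for r'
  proof -
    have "(r, r') \<in> ray_equiv V E" using that r(2) by simp
    then obtain D where D: "D \<in> graph_components E (V - S)" "has_tail_in r D" "has_tail_in r' D"
      using assms(2,3) by (auto simp: ray_equiv_def)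
    then show ?thesis using has_tail_in_component_unique[OF C(1) D(1) C(2) D(2)] by simp
  qed
  moreover have "r \<in> \<omega>"
    using equiv_class_self[OF equiv_ray_equiv] r by blast
  ultimately show ?thesis
    using C has_tail_in_component_unique[of _ E "V - S" _ r] unfolding lives_in_def by blast
qed

lemma topspace_freudenthal:
  assumes "simple_graph V E"
  shows "topspace (freudenthal V E) = freudenthal_points V E"
proof -
  have "\<Union> (freudenthal_basis V E) \<subseteq> freudenthal_points V E"
  proof
    fix p assume "p \<in> \<Union> (freudenthal_basis V E)"
    then obtain B where B: "B \<in> freudenthal_basis V E" "p \<in> B" by blast
    have comp: "C \<subseteq> V" if "C \<in> graph_components E (V - S)" for C S
      using that by (auto simp: graph_components_def reach_on_def elim: quotientE)
    have le: "t < 1" if "t < e" "e \<le> 1" for t e :: real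
      using that by simp
    have gt: "0 < t" if "a < t" "0 \<le> a" for t a :: real
      using that by simp
    from B(1) consider
        v \<epsilon> where "B = vertex_star E v \<epsilon>" "v \<in> V" "0 < \<epsilon>" "\<epsilon> \<le> 1"
      | u v a b where "B = edge_interval u v a b" "{u, v} \<in> E" "0 \<le> a" "b \<le> 1"
      | S C \<epsilon> where "B = end_nbhd V E S C \<epsilon>" "C \<subseteq> V" "\<epsilon> \<le> 1"
      unfolding freudenthal_basis_def using comp by blast
    then show "p \<in> freudenthal_points V E"
    proof cases
      case 1
      then show ?thesis using B(2) le unfolding vertex_star_def freudenthal_points_def by blast
    next
      case 2
      then show ?thesis using B(2) le gt unfolding edge_interval_def freudenthal_points_def by blast
    next
      case 3
      then show ?thesis using B(2) le unfolding end_nbhd_def freudenthal_points_def by blast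
    qed
  qed
  moreover have "freudenthal_points V E \<subseteq> \<Union> (freudenthal_basis V E)"
  proof
    fix p assume "p \<in> freudenthal_points V E"
    then consider v where "v \<in> V" "p = vertex_point v"
      | u v t where "{u, v} \<in> E" "0 < t" "t < 1" "p = edge_point u v t"
      | \<omega> where "\<omega> \<in> ends V E" "p = End \<omega>"
      by (auto simp: freudenthal_points_def)
    then show "p \<in> \<Union> (freudenthal_basis V E)"
    proof cases
      case 1
      have "vertex_star E v 1 \<in> freudenthal_basis V E"
        unfolding freudenthal_basis_def using 1(1) zero_less_one[where 'a=real] by blast
      moreover have "p \<in> vertex_star E v 1"
        using 1 by (simp add: vertex_star_def)
      ultimately show ?thesis by blast
    next
      case 2
      have "edge_interval u v 0 1 \<in> freudenthal_basis V E"
        unfolding freudenthal_basis_def using 2(1) zero_less_one[where 'a=real] by blast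
      moreover have "p \<in> edge_interval u v 0 1"
        using 2 by (auto simp: edge_interval_def)
      ultimately show ?thesis by blast
    next
      case 3
      obtain C where C: "C \<in> graph_components E (V - {})" "lives_in \<omega> C"
        using end_lives_in_component[OF 3(1), of "{}"] by auto
      then have "end_nbhd V E {} C 1 \<in> freudenthal_basis V E"
        unfolding freudenthal_basis_def using 3(1) zero_less_one[where 'a=real]
        by (blast intro: finite.emptyI)
      moreover have "p \<in> end_nbhd V E {} C 1"
        using 3 C by (auto simp: end_nbhd_def)
      ultimately show ?thesis by blast
    qed
  qed
  ultimately show ?thesis
    by (simp add: freudenthal_def)
qed

end

theory Submission
  imports Defs "HOL-Combinatorics.Cycles" "HOL-Complex_Analysis.Great_Picard"
begin

text \<open>Every finite vertex set lies on a cycle: suppose a cycle cannot be extended to contain an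
  adjacent vertex \<open>v\<close>, and let \<open>W\<close> be the set of neighbours of \<open>v\<close> on it. The successors of \<open>W\<close>
  together with \<open>v\<close> form an independent set \<open>U\<close>, and the \<open>L\<^sub>1\<close>-inequalities, summed over \<open>W\<close>,
  are all tight. This forces the cycle to alternate between \<open>W\<close> and \<open>U\<close>, all of \<open>U\<close> to be joined
  to all of \<open>W\<close>, and \<open>W \<union> U\<close> to have no neighbours outside, so the graph would be finite.

  Passing to the limit along cycles containing more and more vertices (as in the theorem of
  Kuendgen, Li and Thomassen) gives a cyclic order of all vertices in which consecutive vertices
  are adjacent and every interval avoiding a finite set \<open>S\<close> lies in one component of \<open>G - S\<close>.
  Giving the \<open>i\<close>-th vertex an interval of length \<open>2^(-i-1)\<close> places the vertices on a circle; the
  intervals are filled with edges, and at each of the remaining points the vertices converge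
  to an end.\<close>

section \<open>Cycles as lists\<close>

text \<open>The hypothesis on common neighbours makes the inequalities usable: tightness determines
  the set of neighbours of \<open>w\<close> adjacent to neither \<open>v\<close> nor the successor
  of \<open>w\<close>, and a second common neighbour supplies in it a successor of some
  \<open>c\<close> other than \<open>w\<close>. Rerouting the cycle through \<open>c\<close> then
  forces the predecessor of \<open>w\<close> into that set, which is the alternation.

  The obstacle in the limit is that cycles converge only as orders. Edges to the next vertex survive
  because a vertex has finitely many candidates for it, but infinitely many vertices may accumulate
  where no edge runs. There only connectivity outside finite sets is left; it survives because
  segments of the finite cycles witness it, and it is exactly what makes the accumulation points
  ends.

  The weights have total 1, so no open interval of the circle stays uncovered and every uncovered
  point is a limit of vertices from both sides. Different uncovered points may receive the same end,
  as a Hamilton curve is allowed to repeat ends.\<close>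

lemma simple_graph_edge:
  assumes "simple_graph V E" "{a, b} \<in> E"
  shows "a \<in> V" "b \<in> V" "a \<noteq> b"
proof -
  obtain u v where "u \<in> V" "v \<in> V" "u \<noteq> v" "{a, b} = {u, v}"
    using assms unfolding simple_graph_def by meson
  then show "a \<in> V" "b \<in> V" "a \<noteq> b" by (auto simp: doubleton_eq_iff)
qed

text \<open>A list fixes a base point and a direction. Its successor map is the library permutation
  \<open>cycle_of_list\<close>, invariant under rotation; its equations, products of transpositions,
  are kept away from the simplifier below. Length 3 excludes a single edge run back and
  forth.\<close>

definition is_cycle :: "'a set set \<Rightarrow> 'a list \<Rightarrow> bool" where
  "is_cycle E xs \<longleftrightarrow> 3 \<le> length xs \<and> distinct xs \<and>
     successively (\<lambda>x y. {x, y} \<in> E) xs \<and> {last xs, hd xs} \<in> E"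

declare cycle_of_list.simps [simp del]

lemma is_cycle_rotate1:
  assumes "is_cycle E xs" shows "is_cycle E (rotate1 xs)"
proof (cases xs)
  case (Cons a ys)
  then show ?thesis
    using assms
    by (cases ys) (auto simp: is_cycle_def successively_append_iff successively_Cons hd_append split: if_splits)
qed (use assms in auto)

lemma is_cycle_rotate: "is_cycle E xs \<Longrightarrow> is_cycle E (rotate n xs)"
  by (induction n) (auto simp: is_cycle_rotate1)

text \<open>After rotating \<open>c\<close> to the front, applying the permutation to the list
  amounts to \<open>rotate1\<close>, and comparing first entries gives the value.\<close>

lemma cycle_of_list_consecutive:
  assumes "distinct (xs @ c # d # ys)"
  shows "cycle_of_list (xs @ c # d # ys) c = d"
proof -
  let ?zs = "c # d # ys @ xs"
  have "cycle_of_list (xs @ c # d # ys) = cycle_of_list ?zs"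
    using cycle_of_list_rotate_independent[OF assms, of "length xs"] by (simp add: rotate_append)
  moreover have "distinct ?zs" using assms by auto
  then have "map (cycle_of_list ?zs) ?zs = rotate1 ?zs"
    using cyclic_rotation[of ?zs 1] by simp
  then have "cycle_of_list ?zs c = d"
    by (simp only: list.map rotate1.simps append_Cons list.inject)
  ultimately show ?thesis by simp
qed

lemma cycle_of_list_last:
  assumes "distinct xs" "xs \<noteq> []"
  shows "cycle_of_list xs (last xs) = hd xs"
proof -
  have "cycle_of_list xs (last xs) = last (map (cycle_of_list xs) xs)"
    using assms(2) by (simp add: last_map)
  also have "\<dots> = last (rotate1 xs)"
    using cyclic_rotation[OF assms(1), of 1] by simp
  also have "\<dots> = hd xs"
    using assms(2) by (cases xs) auto
  finally show ?thesis .
qed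

text \<open>Moves the base point to any vertex without changing the successor map, so that each
  exchange argument can cut the cycle open where it is convenient.\<close>

lemma is_cycle_at:
  assumes "is_cycle E xs" "a \<in> set xs"
  obtains b ys where "is_cycle E (a # b # ys)" "set (a # b # ys) = set xs"
    "cycle_of_list (a # b # ys) = cycle_of_list xs"
proof -
  obtain as bs where xs: "xs = as @ a # bs" using split_list[OF assms(2)] by blast
  let ?zs = "a # bs @ as"
  have rot: "rotate (length as) xs = ?zs" by (simp add: xs rotate_append)
  have zs: "is_cycle E ?zs" using is_cycle_rotate[OF assms(1), of "length as"] rot by simp
  then obtain b ys where bys: "bs @ as = b # ys"
    by (cases "bs @ as") (auto simp: is_cycle_def)
  have "cycle_of_list ?zs = cycle_of_list xs"
    using cycle_of_list_rotate_independent[of xs "length as"] assms(1) rot by (auto simp: is_cycle_def)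
  moreover have "set (a # b # ys) = set xs"
    using arg_cong[OF bys, of set] xs by auto
  ultimately show thesis using that[of b ys] zs bys by simp
qed

lemma cycle_of_list_mem_iff: "cycle_of_list xs x \<in> set xs \<longleftrightarrow> x \<in> set xs"
  using permutes_in_image[OF cycle_permutes[of xs]] .

text \<open>The successor permutation is transitive on the cycle: its \<open>n\<close>-th iterate at
  \<open>a\<close> is the \<open>n\<close>-th entry of the list rotated to start at
  \<open>a\<close>.\<close>

lemma cycle_of_list_closed:
  assumes "distinct xs" "a \<in> set xs" "a \<in> Z" "\<And>x. x \<in> Z \<Longrightarrow> cycle_of_list xs x \<in> Z"
  shows "set xs \<subseteq> Z"
proof
  fix y assume "y \<in> set xs"
  obtain as bs where xs: "xs = as @ a # bs" using split_list[OF assms(2)] by blast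
  let ?zs = "a # bs @ as"
  have d: "distinct ?zs" using assms(1) xs by auto
  have col: "cycle_of_list xs = cycle_of_list ?zs"
    using cycle_of_list_rotate_independent[OF assms(1), of "length as"] by (simp add: xs rotate_append)
  have *: "(cycle_of_list xs ^^ n) a \<in> Z" for n
    by (induction n) (use assms in auto)
  have "y \<in> set ?zs" using \<open>y \<in> set xs\<close> xs by auto
  then obtain n where n: "n < length ?zs" "?zs ! n = y"
    using \<open>y \<in> set ?zs\<close> unfolding in_set_conv_nth by blast
  have "map (cycle_of_list ?zs ^^ n) ?zs ! 0 = rotate n ?zs ! 0"
    using cyclic_rotation[OF d] by metis
  then have "(cycle_of_list ?zs ^^ n) a = ?zs ! n"
    using n(1) nth_rotate[of 0 ?zs n] by simp
  then show "y \<in> Z" using *[of n] col n by simp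
qed

section \<open>Extending cycles\<close>

locale two_joint_L1_graph =
  fixes V :: "'a set" and E :: "'a set set"
  assumes simple: "simple_graph V E"
    and conn: "connected_graph V E"
    and infV: "infinite V"
    and locfin: "locally_finite_graph V E"
    and L1: "L1_graph V E"
    and joint: "\<And>u v. u \<in> V \<Longrightarrow> v \<in> V \<Longrightarrow> gdist V E u v = 2 \<Longrightarrow> card (nbhd E u \<inter> nbhd E v) \<ge> 2"
begin

abbreviation N :: "'a \<Rightarrow> 'a set" where "N \<equiv> nbhd E"

section \<open>Vertices at distance two and the local inequality\<close>

lemma mem_N: "x \<in> N y \<longleftrightarrow> {x, y} \<in> E"
  by (auto simp: nbhd_def insert_commute)

lemmas edge_V = simple_graph_edge[OF simple]

lemma N_sub: "N x \<subseteq> V"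
  using edge_V by (auto simp: nbhd_def)

lemma N_commute: "x \<in> N y \<longleftrightarrow> y \<in> N x"
  by (auto simp: nbhd_def insert_commute)

lemma N_irrefl: "x \<notin> N x"
  using edge_V(3)[of x x] by (auto simp: nbhd_def)

lemma N_mem_V: "x \<in> N y \<Longrightarrow> y \<in> V"
  using N_commute N_sub by blast

lemma finite_N: "finite (N x)"
  using locfin N_mem_V unfolding locally_finite_graph_def by (metis equals0I finite.emptyI)

lemma gdist_eq_2:
  assumes "u \<noteq> v" "u \<notin> N v" "w \<in> N u" "w \<in> N v"
  shows "gdist V E u v = 2"
proof -
  let ?A = "{n. (u, v) \<in> adj_on E V ^^ n}"
  have "(u, w) \<in> adj_on E V" "(w, v) \<in> adj_on E V"
    using assms(3,4) edge_V unfolding adj_on_def mem_N by (auto simp: insert_commute)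
  then have "(u, v) \<in> adj_on E V ^^ Suc (Suc 0)" by auto
  then have 2: "2 \<in> ?A" by (simp add: numeral_2_eq_2)
  have ge: "2 \<le> n" if "n \<in> ?A" for n
  proof (rule ccontr)
    assume "\<not> 2 \<le> n"
    then consider "n = 0" | "n = Suc 0" by linarith
    then show False using that assms(1,2)
      by cases (auto simp: adj_on_def mem_N)
  qed
  show ?thesis unfolding gdist_def
  proof (rule antisym)
    show "(INF n\<in>?A. enat n) \<le> 2"
      using INF_lower[OF 2, of enat] by (simp add: numeral_eq_enat)
    show "2 \<le> (INF n\<in>?A. enat n)"
      using ge by (intro INF_greatest) (auto simp: numeral_eq_enat)
  qed
qed

lemma two_common_neighbours:
  assumes "u \<noteq> v" "u \<notin> N v" "w \<in> N u" "w \<in> N v"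
  shows "card (N u \<inter> N v) \<ge> 2"
  using joint[OF _ _ gdist_eq_2[OF assms]] assms(3,4) N_mem_V by blast

text \<open>Inclusion-exclusion for \<open>N u\<close> and \<open>N v\<close> cancels the union from
  the \<open>L1\<close> inequality. What remains compares neighbours of \<open>w\<close> alone with
  common neighbours of \<open>u\<close> and \<open>v\<close>, the form suited to double
  counting.\<close>

lemma L1_private_neighbours:
  assumes "u \<noteq> v" "u \<notin> N v" "w \<in> N u" "w \<in> N v"
  shows "card (N w - (N u \<union> N v)) \<le> card (N u \<inter> N v) + 1"
proof -
  have "int (card (N u)) + int (card (N v)) \<ge> int (card (N u \<union> N v \<union> N w)) - 1"
    using L1 gdist_eq_2[OF assms] assms N_mem_V N_sub unfolding L1_graph_def degree_def by blast
  moreover have "card (N u \<union> N v \<union> N w) = card (N u \<union> N v) + card (N w - (N u \<union> N v))"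
    using finite_N by (subst card_Un_disjoint[symmetric]) (auto intro: arg_cong[where f=card])
  moreover have "card (N u) + card (N v) = card (N u \<union> N v) + card (N u \<inter> N v)"
    using finite_N card_Un_Int by blast
  ultimately show ?thesis by linarith
qed

text \<open>The cycle \<open>xs\<close> cannot absorb its neighbour \<open>v\<close>, even at the price of further new vertices.\<close>

definition stuck :: "'a list \<Rightarrow> 'a \<Rightarrow> bool" where
  "stuck xs v \<longleftrightarrow> is_cycle E xs \<and> v \<notin> set xs \<and> N v \<inter> set xs \<noteq> {} \<and>
     (\<nexists>ys. is_cycle E ys \<and> insert v (set xs) \<subseteq> set ys)"

section \<open>Rerouting a cycle that cannot absorb a neighbour\<close>

lemma stuckD:
  assumes "stuck xs v"
  shows "is_cycle E xs" "distinct xs" "v \<notin> set xs" "N v \<inter> set xs \<noteq> {}"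
    "\<And>ys. is_cycle E ys \<Longrightarrow> insert v (set xs) \<subseteq> set ys \<Longrightarrow> False"
  using assms unfolding stuck_def is_cycle_def by blast+

text \<open>The path \<open>P\<close> replaces the edge from \<open>a\<close> to \<open>b\<close>.
  The new list starts at \<open>b\<close>, so \<open>P\<close> comes last and the edge from its last
  vertex to \<open>b\<close> closes the cycle.\<close>

lemma is_cycle_insert_path:
  assumes "is_cycle E (a # b # ys)" "P \<noteq> []" "distinct P" "set P \<inter> set (a # b # ys) = {}"
    and "successively (\<lambda>x y. {x, y} \<in> E) P" "{a, hd P} \<in> E" "{last P, b} \<in> E"
  shows "is_cycle E (b # ys @ a # P)"
proof -
  have 1: "distinct (a # b # ys)" "successively (\<lambda>x y. {x, y} \<in> E) (b # ys)"
    "{last (b # ys), a} \<in> E" "1 \<le> length ys"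
    using assms(1) by (auto simp: is_cycle_def)
  have "distinct ((b # ys) @ a # P)"
    using 1(1) assms(3,4) by auto
  moreover have "successively (\<lambda>x y. {x, y} \<in> E) ((b # ys) @ a # P)"
    using 1(2,3) assms(2,5,6) by (subst successively_append_iff) (simp add: successively_Cons)
  moreover have "{last ((b # ys) @ a # P), hd ((b # ys) @ a # P)} \<in> E"
    using assms(2,7) by simp
  ultimately show ?thesis using 1(4) by (simp add: is_cycle_def)
qed

text \<open>Otherwise \<open>v\<close> could be inserted between \<open>a\<close> and its
  successor.\<close>

lemma stuck_succ_nonadj:
  assumes "stuck xs v" "a \<in> N v \<inter> set xs"
  shows "cycle_of_list xs a \<notin> N v"
proof
  obtain b ys where c: "is_cycle E (a # b # ys)" "set (a # b # ys) = set xs"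
    "cycle_of_list (a # b # ys) = cycle_of_list xs"
    using is_cycle_at[OF stuckD(1)[OF assms(1)]] assms(2) by (metis IntD2)
  have b: "cycle_of_list xs a = b"
    using cycle_of_list_consecutive[of "[]" a b ys] c by (simp add: is_cycle_def)
  assume "cycle_of_list xs a \<in> N v"
  then have "{v, b} \<in> E" "{a, v} \<in> E"
    using assms(2) b by (auto simp: mem_N insert_commute)
  then have "is_cycle E (b # ys @ a # [v])"
    using c(2) stuckD(3)[OF assms(1)] by (intro is_cycle_insert_path[OF c(1)]) auto
  then show False using stuckD(5)[OF assms(1)] c(2) by force
qed

text \<open>A common neighbour \<open>x\<close> off the cycle would allow the path \<open>v\<close>,
  \<open>x\<close> to be inserted after \<open>a\<close>. This adds two vertices at once, which is
  why \<open>stuck\<close> excludes all larger cycles through \<open>v\<close>.\<close>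

lemma stuck_common_neighbours:
  assumes "stuck xs v" "a \<in> N v \<inter> set xs"
  shows "N v \<inter> N (cycle_of_list xs a) \<subseteq> set xs"
proof (rule ccontr)
  obtain b ys where c: "is_cycle E (a # b # ys)" "set (a # b # ys) = set xs"
    "cycle_of_list (a # b # ys) = cycle_of_list xs"
    using is_cycle_at[OF stuckD(1)[OF assms(1)]] assms(2) by (metis IntD2)
  have b: "cycle_of_list xs a = b"
    using cycle_of_list_consecutive[of "[]" a b ys] c by (simp add: is_cycle_def)
  assume "\<not> ?thesis"
  then obtain x where x: "x \<in> N v" "x \<in> N b" "x \<notin> set xs" using b by auto
  then have "{x, b} \<in> E" "{a, v} \<in> E" "{v, x} \<in> E" "v \<noteq> x"
    using assms(2) N_irrefl by (auto simp: mem_N insert_commute)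
  then have "is_cycle E (b # ys @ a # [v, x])"
    using c(2) x(3) stuckD(3)[OF assms(1)] by (intro is_cycle_insert_path[OF c(1)]) auto
  then show False using stuckD(5)[OF assms(1)] c(2) by force
qed

text \<open>Crossing argument: from the successor of \<open>a\<close> run forward to
  \<open>c\<close>, step to \<open>v\<close>, then to \<open>a\<close>, and run backward to the
  successor of \<open>c\<close>; the supposed edge between the two successors closes this
  cycle.\<close>

lemma stuck_succs_nonadj:
  assumes "stuck xs v" "a \<in> N v \<inter> set xs" "c \<in> N v \<inter> set xs"
  shows "cycle_of_list xs a \<notin> N (cycle_of_list xs c)"
proof
  assume adj: "cycle_of_list xs a \<in> N (cycle_of_list xs c)"
  then have "a \<noteq> c" using N_irrefl by metis
  obtain b ys where cy: "is_cycle E (a # b # ys)" "set (a # b # ys) = set xs"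
    "cycle_of_list (a # b # ys) = cycle_of_list xs"
    using is_cycle_at[OF stuckD(1)[OF assms(1)]] assms(2) by (metis IntD2)
  have b: "cycle_of_list xs a = b"
    using cycle_of_list_consecutive[of "[]" a b ys] cy by (simp add: is_cycle_def)
  obtain p q where pq: "b # ys = p @ c # q"
    using assms(3) \<open>a \<noteq> c\<close> cy(2) split_list[of c "b # ys"] by force
  \<comment> \<open>Appending \<open>a\<close> treats uniformly the case that \<open>a\<close>
    itself comes right after \<open>c\<close>.\<close>
  obtain d r where dr: "q @ [a] = d # r" by (cases "q @ [a]") auto
  have l: "b # ys @ [a] = p @ c # d # r" using pq dr
    by (metis append_Cons append_assoc)
  have cyl: "is_cycle E (p @ c # d # r)"
    using is_cycle_rotate1[OF cy(1)] l by simp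
  have "cycle_of_list xs = cycle_of_list (p @ c # d # r)"
    using cycle_of_list_rotate_independent[of "a # b # ys" 1] cy l by (simp add: is_cycle_def)
  then have d: "cycle_of_list xs c = d"
    using cycle_of_list_consecutive[of p c d r] cyl unfolding is_cycle_def by metis
  have la: "last (d # r) = a" using dr by (metis last_snoc)
  have hb: "hd (p @ [c]) = b" using pq by (cases p) auto
  have "set (p @ c # d # r) = set (b # ys @ [a])" by (simp only: l)
  also have "\<dots> = set xs" using cy(2) by auto
  finally have s: "set (p @ c # d # r) = set xs" .
  have "is_cycle E ((p @ [c]) @ [v] @ rev (d # r))"
    unfolding is_cycle_def
  proof (intro conjI)
    show "3 \<le> length ((p @ [c]) @ [v] @ rev (d # r))" by simp
    show "distinct ((p @ [c]) @ [v] @ rev (d # r))"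
      using cyl stuckD(3)[OF assms(1)] s by (auto simp: is_cycle_def)
    have "successively (\<lambda>x y. {x, y} \<in> E) (p @ [c])" "successively (\<lambda>x y. {x, y} \<in> E) (d # r)"
      using cyl by (auto simp: is_cycle_def successively_append_iff successively_Cons)
    moreover have "{c, v} \<in> E" "{v, a} \<in> E" using assms(2,3) by (auto simp: mem_N insert_commute)
    ultimately show "successively (\<lambda>x y. {x, y} \<in> E) ((p @ [c]) @ [v] @ rev (d # r))"
      using la by (subst successively_append_iff, subst successively_append_iff)
        (simp only: successively_rev, simp add: hd_rev insert_commute del: rev.simps)
    show "{last ((p @ [c]) @ [v] @ rev (d # r)), hd ((p @ [c]) @ [v] @ rev (d # r))} \<in> E"
      using hb adj b d by (auto simp: mem_N insert_commute hd_append)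
  qed
  moreover have "insert v (set xs) \<subseteq> set ((p @ [c]) @ [v] @ rev (d # r))" using s by auto
  ultimately show False using stuckD(5)[OF assms(1)] by blast
qed

text \<open>Otherwise, with successor map \<open>s\<close>, the vertex \<open>w\<close> can be bypassed by the edge from \<open>p\<close> to
  \<open>s w\<close> and reinserted together with \<open>v\<close> between \<open>c\<close> and \<open>s c\<close>.\<close>

lemma stuck_no_shortcut:
  assumes "stuck xs v" "w \<in> N v \<inter> set xs" "c \<in> N v \<inter> set xs" "c \<noteq> w"
    and "cycle_of_list xs c \<in> N w" "cycle_of_list xs p = w"
  shows "p \<notin> N (cycle_of_list xs w)"
proof
  assume adj: "p \<in> N (cycle_of_list xs w)"
  obtain b ys where cy: "is_cycle E (w # b # ys)" "set (w # b # ys) = set xs"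
    "cycle_of_list (w # b # ys) = cycle_of_list xs"
    using is_cycle_at[OF stuckD(1)[OF assms(1)]] assms(2) by (metis IntD2)
  have b: "cycle_of_list xs w = b"
    using cycle_of_list_consecutive[of "[]" w b ys] cy by (simp add: is_cycle_def)
  have dist: "distinct (w # b # ys)" using cy(1) by (simp add: is_cycle_def)
  have inj: "inj (cycle_of_list xs)"
    using cycle_permutes permutes_inj by blast
  have p: "p = last (b # ys)"
  proof (rule injD[OF inj])
    show "cycle_of_list xs p = cycle_of_list xs (last (b # ys))"
      using cycle_of_list_last[OF dist] assms(6) unfolding cy(3) by simp
  qed
  \<comment> \<open>Were \<open>c\<close> the predecessor of \<open>w\<close>, its successor
    \<open>w\<close> would be adjacent to \<open>v\<close>. Hence the edge after \<open>c\<close> is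
    still there once \<open>w\<close> has been bypassed.\<close>
  have "c \<noteq> p"
    using stuck_succ_nonadj[OF assms(1,3)] assms(2,6) by auto
  obtain l1 l2' where l: "b # ys = l1 @ c # l2'"
    using assms(3,4) cy(2) split_list[of c "b # ys"] by force
  have "l2' \<noteq> []" using l p \<open>c \<noteq> p\<close> by (metis last_snoc)
  then obtain d l2 where l: "b # ys = l1 @ c # d # l2" using l by (cases l2') auto
  have d: "cycle_of_list xs c = d"
    using cycle_of_list_consecutive[of "w # l1" c d l2] dist cy(3) l by simp
  have pl: "p = last (d # l2)" and hb: "b = hd (l1 @ [c])"
    using p l by (simp, cases l1) auto
  have suc: "successively (\<lambda>x y. {x, y} \<in> E) (l1 @ c # d # l2)"
    using cy(1) l by (auto simp: is_cycle_def successively_Cons)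
  have "is_cycle E (l1 @ [c, v, w] @ d # l2)"
    unfolding is_cycle_def
  proof (intro conjI)
    show "distinct (l1 @ [c, v, w] @ d # l2)"
      using dist l stuckD(3)[OF assms(1)] cy(2) by auto
    show "successively (\<lambda>x y. {x, y} \<in> E) (l1 @ [c, v, w] @ d # l2)"
      using suc assms(2,3,5) d
      by (auto simp: successively_append_iff successively_Cons mem_N insert_commute)
    show "{last (l1 @ [c, v, w] @ d # l2), hd (l1 @ [c, v, w] @ d # l2)} \<in> E"
      using adj pl hb b by (auto simp: mem_N hd_append)
  qed simp
  moreover have "insert v (set xs) \<subseteq> set (l1 @ [c, v, w] @ d # l2)"
    using l cy(2) by auto
  ultimately show False using stuckD(5)[OF assms(1)] by blast
qed

section \<open>Counting edges between \<open>W\<close> and its successors\<close>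

lemma is_cycle_succ_adj:
  assumes "is_cycle E xs" "a \<in> set xs"
  shows "cycle_of_list xs a \<in> N a"
proof -
  obtain b ys where c: "is_cycle E (a # b # ys)" "cycle_of_list (a # b # ys) = cycle_of_list xs"
    using is_cycle_at[OF assms] by metis
  have "cycle_of_list xs a = b"
    using cycle_of_list_consecutive[of "[]" a b ys] c by (simp add: is_cycle_def)
  then show ?thesis using c(1) by (simp add: is_cycle_def nbhd_def)
qed

lemma edge_double_count:
  assumes "finite A" "finite B"
  shows "(\<Sum>x\<in>A. card (N x \<inter> B)) = (\<Sum>y\<in>B. card (N y \<inter> A))"
proof -
  have card: "card (N x \<inter> C) = (\<Sum>y\<in>C. of_bool (y \<in> N x))" if "finite C" for x C
    using that by (simp add: of_bool_def sum.If_cases Int_commute)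
  have "(\<Sum>x\<in>A. card (N x \<inter> B)) = (\<Sum>x\<in>A. \<Sum>y\<in>B. of_bool (y \<in> N x))"
    using card[OF assms(2)] by simp
  also have "\<dots> = (\<Sum>y\<in>B. \<Sum>x\<in>A. of_bool (x \<in> N y))"
    by (subst sum.swap) (simp add: N_commute)
  also have "\<dots> = (\<Sum>y\<in>B. card (N y \<inter> A))"
    using card[OF assms(1)] by simp
  finally show ?thesis .
qed

text \<open>Summing the \<open>L\<^sub>1\<close>-inequalities over \<open>W\<close> and double counting the edges between \<open>W\<close> and
  its successors turns all of them into equalities.\<close>

lemma stuck_tight:
  assumes st: "stuck xs v" and w: "w \<in> N v \<inter> set xs"
  defines "s \<equiv> cycle_of_list xs" and "W \<equiv> N v \<inter> set xs"
  shows "N w - (N v \<union> N (s w)) = insert v (N w \<inter> s ` W)" and "2 \<le> card (N w \<inter> s ` W)"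
    and "2 \<le> card W"
proof -
  have fW: "finite W" by (simp add: W_def)
  have v: "v \<notin> s ` W"
    using stuckD(3)[OF st] by (auto simp: s_def W_def cycle_of_list_mem_iff)
  have inj: "inj s" unfolding s_def by (meson cycle_permutes permutes_inj)
  have sub: "insert v (N x \<inter> s ` W) \<subseteq> N x - (N v \<union> N (s x))"
    and cap: "N v \<inter> N (s x) = N (s x) \<inter> W"
    and le: "card (N x \<inter> s ` W) \<le> card (N (s x) \<inter> W)"
    and two: "2 \<le> card (N (s x) \<inter> W)"
    and L: "card (N x - (N v \<union> N (s x))) \<le> card (N (s x) \<inter> W) + 1"
    if x: "x \<in> W" for x
  proof -
    have nv: "s x \<notin> N v" using stuck_succ_nonadj[OF st] x by (simp add: s_def W_def)
    show sub: "insert v (N x \<inter> s ` W) \<subseteq> N x - (N v \<union> N (s x))"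
    proof -
      have "v \<in> N x" using x N_commute by (auto simp: W_def)
      moreover have "v \<notin> N (s x)" using nv N_commute by blast
      moreover have "s c \<notin> N v" "s c \<notin> N (s x)" if "c \<in> W" for c
        using stuck_succ_nonadj[OF st] stuck_succs_nonadj[OF st] x that by (auto simp: s_def W_def)
      ultimately show ?thesis using N_irrefl by blast
    qed
    show cap: "N v \<inter> N (s x) = N (s x) \<inter> W"
      using stuck_common_neighbours[OF st, of x] x unfolding s_def W_def by blast
    have *: "v \<noteq> s x" "v \<notin> N (s x)" "x \<in> N v" "x \<in> N (s x)"
      using v x nv N_commute is_cycle_succ_adj[OF stuckD(1)[OF st], of x]
      unfolding s_def W_def by blast+
    show two: "2 \<le> card (N (s x) \<inter> W)"
      using two_common_neighbours[OF *] cap by simp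
    show L: "card (N x - (N v \<union> N (s x))) \<le> card (N (s x) \<inter> W) + 1"
      using L1_private_neighbours[OF *] cap by simp
    \<comment> \<open>The vertex \<open>v\<close> itself uses up the \<open>+ 1\<close> in
      \<open>L\<close>; the successors adjacent to \<open>x\<close> must fit into the rest.\<close>
    have "card (insert v (N x \<inter> s ` W)) = card (N x \<inter> s ` W) + 1"
      using v fW by simp
    moreover have "card (insert v (N x \<inter> s ` W)) \<le> card (N x - (N v \<union> N (s x)))"
      using sub finite_N by (intro card_mono) auto
    ultimately show "card (N x \<inter> s ` W) \<le> card (N (s x) \<inter> W)" using L by linarith
  qed
  have "(\<Sum>x\<in>W. card (N (s x) \<inter> W)) = (\<Sum>y\<in>s ` W. card (N y \<inter> W))"
    using inj by (subst sum.reindex) (auto intro: inj_on_subset)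
  also have "\<dots> = (\<Sum>x\<in>W. card (N x \<inter> s ` W))"
    using edge_double_count fW by blast
  finally have sums: "(\<Sum>x\<in>W. card (N x \<inter> s ` W)) = (\<Sum>x\<in>W. card (N (s x) \<inter> W))" by simp
  \<comment> \<open>Termwise inequality with equal sums leaves no slack in any term.\<close>
  have eq: "card (N x \<inter> s ` W) = card (N (s x) \<inter> W)" if "x \<in> W" for x
    using sum_mono_inv[OF sums le that fW] .
  have wW: "w \<in> W" using w by (simp add: W_def)
  show "2 \<le> card (N w \<inter> s ` W)" using two eq wW by simp
  have "card (N w - (N v \<union> N (s w))) \<le> card (insert v (N w \<inter> s ` W))"
    using L[OF wW] eq[OF wW] v fW by simp
  then show "N w - (N v \<union> N (s w)) = insert v (N w \<inter> s ` W)"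
    using card_seteq[OF _ sub[OF wW]] finite_N by blast
  have "card (N (s w) \<inter> W) \<le> card W" using fW by (intro card_mono) auto
  then show "2 \<le> card W" using two[OF wW] by simp
qed

text \<open>The predecessor \<open>p\<close> of \<open>w\<close> is adjacent to \<open>w\<close> but
  neither to \<open>v\<close> nor to the successor of \<open>w\<close>, so tightness places it among
  the successors of \<open>W\<close>. Thus two steps along the cycle map \<open>W\<close> onto
  itself, by cardinality, and \<open>W\<close> with its successors is closed under the successor
  map.\<close>

lemma stuck_alternating:
  assumes st: "stuck xs v"
  defines "s \<equiv> cycle_of_list xs" and "W \<equiv> N v \<inter> set xs"
  shows "s ` s ` W = W" "set xs = W \<union> s ` W"
proof -
  have fW: "finite W" by (simp add: W_def)
  have inj: "inj s" unfolding s_def by (meson cycle_permutes permutes_inj)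
  have "w \<in> s ` s ` W" if w: "w \<in> W" for w
  proof -
    have "w \<in> s ` set xs"
      using w cycle_is_surj[OF stuckD(2)[OF st]] by (simp add: W_def s_def)
    then obtain p where p: "p \<in> set xs" "s p = w" by blast
    have "p \<in> N w"
      using is_cycle_succ_adj[OF stuckD(1)[OF st] p(1)] p(2) N_commute by (simp add: s_def)
    moreover have "p \<notin> N v"
      using stuck_succ_nonadj[OF st, of p] p w by (auto simp: s_def W_def)
    moreover have "p \<notin> N (s w)"
    proof -
      \<comment> \<open>The bound 2, inherited from the common neighbours, yields a successor of
        some \<open>c\<close> other than \<open>w\<close> adjacent to \<open>w\<close>, as the
        shortcut argument requires.\<close>
      have "\<not> N w \<inter> s ` W \<subseteq> {s w}"
      proof
        assume "N w \<inter> s ` W \<subseteq> {s w}"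
        then have "card (N w \<inter> s ` W) \<le> card {s w}" by (intro card_mono) auto
        then show False using stuck_tight(2)[OF st, of w] w by (simp add: s_def W_def)
      qed
      then obtain c where "c \<in> W" "c \<noteq> w" "s c \<in> N w" by blast
      then show ?thesis
        using stuck_no_shortcut[OF st, of w c p] w p(2) by (simp add: s_def W_def)
    qed
    moreover have "p \<noteq> v" using p stuckD(3)[OF st] by blast
    ultimately have "p \<in> s ` W"
      using stuck_tight(1)[OF st, of w] w unfolding s_def W_def by blast
    then show ?thesis using p(2) by blast
  qed
  then have "W \<subseteq> s ` s ` W" by blast
  moreover have "card (s ` s ` W) = card W"
    using inj by (metis card_image inj_on_subset subset_UNIV)
  ultimately show ss: "s ` s ` W = W"
    using fW by (metis card_subset_eq finite_imageI)
  obtain a where a: "a \<in> W" using stuckD(4)[OF st] by (auto simp: W_def)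
  have "s x \<in> W \<union> s ` W" if "x \<in> W \<union> s ` W" for x using that ss by blast
  then have "set xs \<subseteq> W \<union> s ` W"
    using cycle_of_list_closed[OF stuckD(2)[OF st], of a "W \<union> s ` W"] a
    unfolding s_def W_def by blast
  moreover have "W \<union> s ` W \<subseteq> set xs"
    by (auto simp: W_def s_def cycle_of_list_mem_iff)
  ultimately show "set xs = W \<union> s ` W" by blast
qed

text \<open>By the last claim, every vertex of \<open>U\<close> can be exchanged with \<open>v\<close>, so statements about
  \<open>v\<close> carry over to all of \<open>U\<close>.\<close>

lemma stuck_structure:
  assumes st: "stuck xs v"
  defines "W \<equiv> N v \<inter> set xs" and "U \<equiv> insert v (set xs) - N v"
  shows "\<And>a b. a \<in> U \<Longrightarrow> b \<in> U \<Longrightarrow> a \<notin> N b" "card U = card W + 1" "2 \<le> card W"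
    "\<And>u. u \<in> U \<Longrightarrow> u \<noteq> v \<Longrightarrow> N v \<inter> N u \<subseteq> W"
    "\<And>u. u \<in> U \<Longrightarrow> \<exists>ys. stuck ys u \<and> insert u (set ys) = insert v (set xs)"
proof -
  define s where "s = cycle_of_list xs"
  have inj: "inj s" unfolding s_def by (meson cycle_permutes permutes_inj)
  have vxs: "v \<notin> set xs" using stuckD(3)[OF st] .
  have nonadj: "s c \<notin> N v" if "c \<in> W" for c
    using stuck_succ_nonadj[OF st, of c] that by (simp add: s_def W_def)
  have xs: "set xs = W \<union> s ` W" and ss: "s ` s ` W = W"
    using stuck_alternating[OF st] by (simp_all add: s_def W_def)
  have U: "U = insert v (s ` W)"
    using xs nonadj N_irrefl unfolding U_def W_def by blast
  have v: "v \<notin> s ` W" using vxs xs by blast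
  obtain w0 where "w0 \<in> W" using stuckD(4)[OF st] by (auto simp: W_def)
  then show "2 \<le> card W" using stuck_tight(3)[OF st, of w0] by (simp add: W_def)
  show "card U = card W + 1"
    using v inj by (simp add: U W_def card_image inj_on_subset)
  show "a \<notin> N b" if "a \<in> U" "b \<in> U" for a b
  proof -
    have "s c \<notin> N (s d)" if "c \<in> W" "d \<in> W" for c d
      using stuck_succs_nonadj[OF st] that by (simp add: s_def W_def)
    then show ?thesis using that nonadj N_irrefl N_commute unfolding U by blast
  qed
  show "N v \<inter> N u \<subseteq> W" if "u \<in> U" "u \<noteq> v" for u
    using stuck_common_neighbours[OF st] that unfolding U s_def W_def by blast
  show "\<exists>ys. stuck ys u \<and> insert u (set ys) = insert v (set xs)" if "u \<in> U" for u
  proof (cases "u = v")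
    case False
    then obtain w where w: "w \<in> W" "u = s w" using \<open>u \<in> U\<close> U by blast
    obtain b ys where c: "is_cycle E (w # b # ys)" "set (w # b # ys) = set xs"
      "cycle_of_list (w # b # ys) = cycle_of_list xs"
      using is_cycle_at[OF stuckD(1)[OF st]] w(1) unfolding W_def by (metis IntD2)
    obtain d zs where ys: "ys = d # zs" using c(1) by (cases ys) (auto simp: is_cycle_def)
    have dist: "distinct (w # b # ys)" using c(1) by (simp add: is_cycle_def)
    have u: "u = b"
      using cycle_of_list_consecutive[of "[]" w b ys] dist c(3) w(2) by (simp add: s_def)
    have "s b = d"
      using cycle_of_list_consecutive[of "[w]" b d zs] dist c(3) ys by (simp add: s_def)
    then have "d \<in> W" using ss w u by blast
    then have adj: "{w, v} \<in> E" "{v, d} \<in> E"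
      using w(1) by (auto simp: W_def mem_N insert_commute)
    have "v \<noteq> w" "v \<notin> set ys" using vxs c(2) by auto
    \<comment> \<open>On the cycle \<open>v\<close> takes the place of \<open>u\<close>, whose two
      neighbours there lie in \<open>W\<close>. Cycle plus leftover vertex span the same set as
      before, so a cycle absorbing \<open>u\<close> would have absorbed \<open>v\<close> into the
      old one.\<close>
    then have cyc: "is_cycle E (w # v # ys)"
      using c(1) adj by (simp add: is_cycle_def ys successively_Cons)
    have set: "insert b (set (w # v # ys)) = insert v (set xs)" using c(2) by auto
    have "b \<notin> set (w # v # ys)" using dist vxs c(2) by auto
    moreover have "w \<in> N b" using c(1) by (simp add: is_cycle_def mem_N)
    ultimately have "stuck (w # v # ys) b"
      using cyc stuckD(5)[OF st] set unfolding stuck_def by auto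
    then show ?thesis using u set by blast
  qed (use st in blast)
qed

text \<open>By connectivity such a set contains all of \<open>V\<close>; this is how infinitude of
  the graph contradicts a finite closed configuration.\<close>

lemma closed_set_infinite:
  assumes "a \<in> Y" "a \<in> V" "\<And>x y. x \<in> Y \<Longrightarrow> y \<in> N x \<Longrightarrow> y \<in> Y"
  shows "infinite Y"
proof -
  have "V \<subseteq> Y"
  proof
    fix y assume that: "y \<in> V"
    have "(a, y) \<in> (adj_on E V)\<^sup>*"
      using conn assms(2) that by (simp add: connected_graph_def)
    then show "y \<in> Y"
      by (induction) (use assms in \<open>auto simp: adj_on_def nbhd_def\<close>)
  qed
  then show ?thesis using infV finite_subset by metis
qed

theorem not_stuck: "\<not> stuck xs v"
proof
  assume st: "stuck xs v"
  define Y W U where "Y = insert v (set xs)" and "W = N v \<inter> set xs" and "U = Y - N v"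
  note S = stuck_structure[OF st, folded W_def, folded Y_def, folded U_def]
  have fin: "finite W" "finite U" "finite Y" by (auto simp: W_def U_def Y_def)
  have Y: "Y = W \<union> U" "W \<inter> U = {}" using N_irrefl by (auto simp: Y_def W_def U_def)
  have cY: "card Y = 2 * card W + 1"
    using Y fin S(2) by (simp add: card_Un_disjoint)
  \<comment> \<open>After exchanging \<open>u\<close> with \<open>v\<close>, the non-neighbours of
    \<open>u\<close> in \<open>Y\<close> again outnumber half of \<open>Y\<close>: there are
    \<open>card W + 1\<close> of them. So \<open>u\<close> has \<open>card W\<close> neighbours in
    \<open>Y\<close>, all in \<open>W\<close> by independence of \<open>U\<close>, hence exactly
    \<open>W\<close>.\<close>
  have sub: "W \<subseteq> N u" and com: "\<And>u'. u' \<in> U \<Longrightarrow> u' \<noteq> u \<Longrightarrow> N u \<inter> N u' \<subseteq> W" if u: "u \<in> U" for u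
  proof -
    obtain ys where ys: "stuck ys u" "insert u (set ys) = Y" using S(5)[OF u] by blast
    note T = stuck_structure[OF ys(1), unfolded ys(2)]
    have "N u \<inter> set ys \<subseteq> W"
      using S(1)[OF _ u] ys(2) Y by blast
    moreover have "card (N u \<inter> set ys) = card W"
    proof -
      have "Y = (N u \<inter> set ys) \<union> (Y - N u)" "(N u \<inter> set ys) \<inter> (Y - N u) = {}"
        using ys(2) N_irrefl by auto
      then have "card Y = card (N u \<inter> set ys) + card (Y - N u)"
        using fin(3) by (metis card_Un_disjoint finite_Un)
      then show ?thesis using T(2) cY by linarith
    qed
    ultimately have eq: "N u \<inter> set ys = W" using fin(1) by (metis card_subset_eq)
    then show "W \<subseteq> N u" by blast
    fix u' assume "u' \<in> U" "u' \<noteq> u"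
    then show "N u \<inter> N u' \<subseteq> W" using T(4)[of u'] eq Y S(1)[OF _ u] by blast
  qed
  \<comment> \<open>If \<open>x\<close> outside \<open>Y\<close> were adjacent to \<open>w\<close>
    but to neither of two vertices of \<open>U\<close>, then \<open>U\<close> and \<open>x\<close>
    would give \<open>card W + 2\<close> private neighbours where the inequality allows
    \<open>card W + 1\<close>. So \<open>x\<close> misses at most one of three vertices of
    \<open>U\<close>, is a common neighbour of two, and lies in \<open>W\<close> after all.\<close>
  have wY: "N w \<subseteq> Y" if w: "w \<in> W" for w
  proof (rule ccontr)
    assume "\<not> N w \<subseteq> Y"
    then obtain x where x: "x \<in> N w" "x \<notin> Y" by blast
    have pair: "x \<in> N u \<union> N u'" if u: "u \<in> U" "u' \<in> U" "u \<noteq> u'" for u u'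
    proof (rule ccontr)
      assume "x \<notin> N u \<union> N u'"
      moreover have "U \<subseteq> N w - (N u \<union> N u')"
        using S(1) u sub w N_commute by blast
      ultimately have "insert x U \<subseteq> N w - (N u \<union> N u')" using x by blast
      then have "card (insert x U) \<le> card (N w - (N u \<union> N u'))"
        using finite_N by (intro card_mono) auto
      moreover have "card (N w - (N u \<union> N u')) \<le> card (N u \<inter> N u') + 1"
        using u w sub S(1) by (intro L1_private_neighbours) auto
      moreover have "card (N u \<inter> N u') \<le> card W"
        using com[OF u(1), of u'] u fin(1) by (intro card_mono) auto
      moreover have "card (insert x U) = card U + 1" using x fin Y by simp
      ultimately show False using S(2) by linarith
    qed
    have "3 \<le> card U" using S(2,3) by simp
    then obtain A where A: "A \<subseteq> U" "card A = 3"
      using obtain_subset_with_card_n by metis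
    then obtain u1 u2 u3 where u: "u1 \<in> U" "u2 \<in> U" "u3 \<in> U" "u1 \<noteq> u2" "u2 \<noteq> u3" "u1 \<noteq> u3"
      unfolding card_3_iff by blast
    have "x \<in> W"
      using pair[OF u(1,2,4)] pair[OF u(2,3,5)] pair[OF u(1,3,6)]
        com[OF u(1), of u2] com[OF u(1), of u3] com[OF u(2), of u3] u by blast
    then show False using x Y by blast
  qed
  \<comment> \<open>An outside neighbour \<open>x\<close> of \<open>u\<close> has distance two from
    \<open>w\<close>, and the second common neighbour \<open>y\<close> of \<open>x\<close> and
    \<open>w\<close> must lie in \<open>U\<close> by \<open>wY\<close>. Then \<open>x\<close> is a
    common neighbour of \<open>u\<close> and \<open>y\<close>, hence in \<open>W\<close>.\<close>
  have uY: "N u \<subseteq> Y" if u: "u \<in> U" for u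
  proof (rule ccontr)
    assume "\<not> N u \<subseteq> Y"
    then obtain x where x: "x \<in> N u" "x \<notin> Y" by blast
    obtain w where w: "w \<in> W" using S(3) by fastforce
    have *: "x \<noteq> w" "x \<notin> N w" "u \<in> N x" "u \<in> N w"
      using x w wY Y sub[OF u] N_commute by blast+
    have "\<not> N x \<inter> N w \<subseteq> {u}"
    proof
      assume "N x \<inter> N w \<subseteq> {u}"
      then have "card (N x \<inter> N w) \<le> card {u}" by (intro card_mono) auto
      then show False using two_common_neighbours[OF *] by simp
    qed
    then obtain y where y: "y \<in> N x" "y \<in> N w" "y \<noteq> u" by blast
    then have "y \<in> W \<union> U" using wY[OF w] Y by blast
    moreover have "y \<notin> W" using wY x y(1) N_commute by blast
    ultimately have "y \<in> U" by blast
    then have "x \<in> W" using com[OF u, of y] x y N_commute by blast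
    then show False using x Y by blast
  qed
  have "v \<in> V" using stuckD(4)[OF st] N_mem_V by blast
  then have "infinite Y"
    using closed_set_infinite[of v Y] wY uY Y unfolding Y_def by blast
  then show False using fin by blast
qed

section \<open>Cycles through prescribed vertices\<close>

lemma extend_cycle:
  assumes "is_cycle E xs" "v \<in> V"
  shows "\<exists>ys. is_cycle E ys \<and> insert v (set xs) \<subseteq> set ys"
proof -
  have "xs \<noteq> []" using assms(1) by (auto simp: is_cycle_def)
  then have hd: "hd xs \<in> set xs" "{last xs, hd xs} \<in> E"
    using assms(1) by (simp_all add: is_cycle_def)
  then have "hd xs \<in> V" using edge_V by blast
  then have "(hd xs, v) \<in> (adj_on E V)\<^sup>*"
    using conn assms(2) by (simp add: connected_graph_def)
  \<comment> \<open>Induction along a walk from the cycle to \<open>v\<close>: the next vertex is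
    adjacent to the cycle built so far, so it is on it or can be absorbed.\<close>
  then show ?thesis
  proof induction
    case base
    then show ?case using assms(1) hd by blast
  next
    case (step y z)
    then obtain ys where ys: "is_cycle E ys" "insert y (set xs) \<subseteq> set ys" by blast
    have "y \<in> N z" using step(2) by (simp add: adj_on_def mem_N)
    then show ?case using ys not_stuck[of ys z] unfolding stuck_def by blast
  qed
qed

text \<open>The finite set of \<open>a\<close> and its neighbours is not closed under adjacency, so
  some \<open>y\<close> has distance two from \<open>a\<close>; two common neighbours complete a
  4-cycle.\<close>

lemma cycle_exists: "\<exists>xs. is_cycle E xs"
proof -
  obtain a where a: "a \<in> V" using infV by fastforce
  let ?Y = "insert a (N a)"
  have "finite ?Y" using finite_N by simp
  then obtain x y where xy: "x \<in> ?Y" "y \<in> N x" "y \<notin> ?Y"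
    using closed_set_infinite[of a ?Y] a by blast
  then have *: "a \<noteq> y" "a \<notin> N y" "x \<in> N a" "x \<in> N y" using N_commute by blast+
  have "\<not> N a \<inter> N y \<subseteq> {x}"
  proof
    assume "N a \<inter> N y \<subseteq> {x}"
    then have "card (N a \<inter> N y) \<le> card {x}" by (intro card_mono) auto
    then show False using two_common_neighbours[OF *] by simp
  qed
  then obtain z where "z \<in> N a" "z \<in> N y" "z \<noteq> x" by blast
  then have "is_cycle E [a, x, y, z]"
    using * N_irrefl N_commute by (auto simp: is_cycle_def nbhd_def insert_commute)
  then show ?thesis by blast
qed

theorem cycle_through_finite_set:
  assumes "finite S" "S \<subseteq> V"
  shows "\<exists>xs. is_cycle E xs \<and> S \<subseteq> set xs"
  using assms
proof induction
  case empty
  then show ?case using cycle_exists by simp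
next
  case (insert v S)
  then obtain xs where "is_cycle E xs" "S \<subseteq> set xs" by auto
  then show ?case using extend_cycle[of xs v] insert.prems by blast
qed

end

section \<open>Limits of cycles\<close>

lemma is_cycle_subset:
  assumes "simple_graph V E" "is_cycle E xs"
  shows "set xs \<subseteq> V"
proof
  fix x assume "x \<in> set xs"
  then obtain b ys where "is_cycle E (x # b # ys)"
    using is_cycle_at[OF assms(2)] by metis
  then have "{x, b} \<in> E" by (simp add: is_cycle_def)
  then show "x \<in> V" by (rule simple_graph_edge(1)[OF assms(1)])
qed

definition before :: "'a list \<Rightarrow> 'a \<Rightarrow> 'a \<Rightarrow> bool" where
  "before xs x y \<longleftrightarrow> (\<exists>i j. i < j \<and> j < length xs \<and> xs ! i = x \<and> xs ! j = y)"

lemma before_nth: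
  assumes "distinct xs" "i < length xs" "j < length xs"
  shows "before xs (xs ! i) (xs ! j) \<longleftrightarrow> i < j"
  using assms nth_eq_iff_index_eq[OF assms(1)] unfolding before_def
  by (metis order.strict_trans)

text \<open>The vertex \<open>0\<close> serves as the first vertex of the cyclic order, so it also follows the last one.\<close>

definition follows :: "(nat \<Rightarrow> nat \<Rightarrow> bool) \<Rightarrow> nat \<Rightarrow> nat \<Rightarrow> bool" where
  "follows lt i j \<longleftrightarrow> (\<forall>l. lt l j \<longleftrightarrow> l = i \<or> lt l i) \<or> j = 0 \<and> (\<forall>l. l \<noteq> i \<longrightarrow> lt l i)"

text \<open>Records what survives of the cycles in the limit: \<open>succ_exists\<close> and
  \<open>pred_exists\<close> keep the edges, \<open>interval_connected\<close> controls the places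
  where vertices accumulate. The cyclic order is cut open before index 0 to become linear.\<close>

locale vertex_order =
  fixes V :: "'a set" and E :: "'a set set" and e :: "nat \<Rightarrow> 'a" and lt :: "nat \<Rightarrow> nat \<Rightarrow> bool"
  assumes simple: "simple_graph V E"
    and bij_e: "bij_betw e UNIV V"
    and lt_irrefl: "\<not> lt i i"
    and lt_trans: "lt i j \<Longrightarrow> lt j k \<Longrightarrow> lt i k"
    and lt_total: "i \<noteq> j \<Longrightarrow> lt i j \<or> lt j i"
    and lt_zero: "i \<noteq> 0 \<Longrightarrow> lt 0 i"
    and succ_exists: "\<exists>j. {e i, e j} \<in> E \<and> follows lt i j"
    and pred_exists: "\<exists>j. {e j, e i} \<in> E \<and> follows lt j i"
    and interval_connected: "lt a b \<Longrightarrow> finite S \<Longrightarrow> (\<And>s. s \<in> S \<Longrightarrow> lt s a \<or> lt b s)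
      \<Longrightarrow> (e a, e b) \<in> reach_on E (V - e ` S)"

text \<open>Only finitely many vertices end walks of length \<open>n\<close> from \<open>a\<close>,
  and every vertex ends one of some length.\<close>

lemma countable_connected_graph:
  assumes "connected_graph V E" "locally_finite_graph V E"
  shows "countable V"
proof (cases "V = {}")
  case False
  then obtain a where a: "a \<in> V" by blast
  have fin: "finite ((adj_on E V ^^ n) `` {a})" for n
  proof (induction n)
    case (Suc n)
    have "finite (adj_on E V `` {x})" for x
    proof (cases "x \<in> V")
      case True
      then have "finite (nbhd E x)" using assms(2) by (simp add: locally_finite_graph_def)
      then show ?thesis by (rule finite_subset[rotated]) (auto simp: adj_on_def nbhd_def)
    qed (simp add: adj_on_def Image_def)
    moreover have "(adj_on E V ^^ Suc n) `` {a} = (\<Union>x\<in>(adj_on E V ^^ n) `` {a}. adj_on E V `` {x})"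
      by auto
    ultimately show ?case using Suc by simp
  qed simp
  have "V \<subseteq> (\<Union>n. (adj_on E V ^^ n) `` {a})"
  proof
    fix x assume "x \<in> V"
    then have "(a, x) \<in> (adj_on E V)\<^sup>*" using assms(1) a by (simp add: connected_graph_def)
    then show "x \<in> (\<Union>n. (adj_on E V ^^ n) `` {a})" by (auto simp: rtrancl_power)
  qed
  moreover have "countable (\<Union>n. (adj_on E V ^^ n) `` {a})"
    using fin by (intro countable_UN) (auto intro: countable_finite)
  ultimately show ?thesis by (rule countable_subset)
qed simp

text \<open>The diagonal argument is borrowed from bounded real functions on a countable set,
  applied to indicator functions; a convergent sequence of zeros and ones is eventually
  constant.\<close>

lemma convergent_bool_subsequence:
  fixes P :: "nat \<Rightarrow> 'b::countable \<Rightarrow> bool"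
  obtains k where "strict_mono (k :: nat \<Rightarrow> nat)"
    "\<And>x. (\<forall>\<^sub>F n in sequentially. P (k n) x) \<or> (\<forall>\<^sub>F n in sequentially. \<not> P (k n) x)"
proof -
  obtain k where k: "strict_mono (k :: nat \<Rightarrow> nat)"
    "\<And>x. x \<in> UNIV \<Longrightarrow> \<exists>l. (\<lambda>n. of_bool (P (k n) x) :: real) \<longlonglongrightarrow> l"
    by (rule function_convergent_subsequence[of UNIV "\<lambda>n x. of_bool (P n x) :: real" 1]) auto
  have "(\<forall>\<^sub>F n in sequentially. P (k n) x) \<or> (\<forall>\<^sub>F n in sequentially. \<not> P (k n) x)" for x
  proof -
    obtain l where "(\<lambda>n. of_bool (P (k n) x) :: real) \<longlonglongrightarrow> l" using k(2) by blast
    then have close: "\<forall>\<^sub>F n in sequentially. dist (of_bool (P (k n) x)) l < 1/2"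
      by (rule tendstoD) simp
    show ?thesis
    proof (cases "dist 1 l < 1/2")
      case True
      then have "\<not> dist 0 l < 1/2" by (auto simp: dist_real_def)
      then show ?thesis using close
        by (intro disjI1) (auto elim!: eventually_mono split: if_splits simp: of_bool_def)
    next
      case False
      then show ?thesis using close
        by (intro disjI2) (auto elim!: eventually_mono split: if_splits simp: of_bool_def)
    qed
  qed
  then show thesis using that k(1) by blast
qed

text \<open>Along a subsequence the relative order of every two vertices becomes constant, and this
  defines \<open>lt\<close>. Any finite part of \<open>lt\<close> is realised on a single cycle, so
  order axioms and connectivity transfer. The successor of a vertex need not be known to stabilise:
  some neighbour takes this role infinitely often, and as \<open>lt\<close> is already decided, this
  suffices.\<close>

theorem vertex_order_of_cycles:
  assumes simple: "simple_graph V E" and conn: "connected_graph V E" and inf: "infinite V"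
    and locfin: "locally_finite_graph V E"
    and cycles: "\<And>S. finite S \<Longrightarrow> S \<subseteq> V \<Longrightarrow> \<exists>xs. is_cycle E xs \<and> S \<subseteq> set xs"
  obtains e lt where "vertex_order V E e lt"
proof -
  define e where "e = from_nat_into V"
  have bij: "bij_betw e UNIV V"
    unfolding e_def using bij_betw_from_nat_into[OF countable_connected_graph[OF conn locfin] inf] .
  then have e_V: "e i \<in> V" and e_inj: "e i = e j \<longleftrightarrow> i = j" for i j
    by (auto simp: bij_betw_def inj_eq)
  have "\<exists>xs. is_cycle E xs \<and> e ` {..n} \<subseteq> set xs \<and> hd xs = e 0" for n
  proof -
    obtain xs where xs: "is_cycle E xs" "e ` {..n} \<subseteq> set xs"
      using cycles[of "e ` {..n}"] e_V by blast
    then have "e 0 \<in> set xs" by blast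
    then obtain b ys where "is_cycle E (e 0 # b # ys)" "set (e 0 # b # ys) = set xs"
      using is_cycle_at[OF xs(1)] by metis
    then show ?thesis using xs(2) by (metis list.sel(1))
  qed
  then obtain c where c: "\<And>n. is_cycle E (c n)" "\<And>n. e ` {..n} \<subseteq> set (c n)" "\<And>n. hd (c n) = e 0"
    by metis
  obtain k where k: "strict_mono (k :: nat \<Rightarrow> nat)"
    and conv: "\<And>x. (\<forall>\<^sub>F n in sequentially. case x of (i, j) \<Rightarrow> before (c (k n)) (e i) (e j)) \<or>
        (\<forall>\<^sub>F n in sequentially. \<not> (case x of (i, j) \<Rightarrow> before (c (k n)) (e i) (e j)))"
    using convergent_bool_subsequence[of "\<lambda>n x. case x of (i, j) \<Rightarrow> before (c n) (e i) (e j)"] by blast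
  define d where "d n = c (k n)" for n
  have d_cycle: "is_cycle E (d n)" and d_dist: "distinct (d n)" and d_hd: "d n ! 0 = e 0"
    and d_len: "3 \<le> length (d n)" for n
  proof -
    show "is_cycle E (d n)" using c(1) by (simp add: d_def)
    then show "distinct (d n)" "3 \<le> length (d n)" by (simp_all add: is_cycle_def)
    then show "d n ! 0 = e 0" using c(3)[of "k n"] by (simp add: d_def hd_conv_nth flip: length_0_conv)
  qed
  have d_V: "d n ! m \<in> V" if "m < length (d n)" for n m
    using is_cycle_subset[OF simple d_cycle] that nth_mem by blast
  have d_index: "\<exists>m < length (d n). d n ! m = e i" if "i \<le> n" for i n
  proof -
    have "i \<le> k n" using that strict_mono_imp_increasing[OF k, of n] by simp
    then have "e i \<in> set (d n)" using c(2)[of "k n"] by (auto simp: d_def)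
    then show ?thesis by (simp add: in_set_conv_nth)
  qed
  have d_inverse: "\<exists>i. d n ! m = e i" if "m < length (d n)" for n m
    using d_V[OF that] bij by (metis UNIV_I bij_betw_def image_iff)
  define lt where "lt i j \<longleftrightarrow> (\<forall>\<^sub>F n in sequentially. before (d n) (e i) (e j))" for i j
  have ev1: "\<forall>\<^sub>F n in sequentially. before (d n) (e i) (e j) \<longleftrightarrow> lt i j" for i j
    using conv[of "(i, j)"]
  proof
    assume "\<forall>\<^sub>F n in sequentially. case (i, j) of (i, j) \<Rightarrow> before (c (k n)) (e i) (e j)"
    then show ?thesis by (auto simp: lt_def d_def elim: eventually_mono)
  next
    assume *: "\<forall>\<^sub>F n in sequentially. \<not> (case (i, j) of (i, j) \<Rightarrow> before (c (k n)) (e i) (e j))"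
    have "\<not> lt i j"
    proof
      assume "lt i j"
      then have "\<forall>\<^sub>F n in sequentially. False"
        using * unfolding lt_def by eventually_elim (simp add: d_def)
      then show False by simp
    qed
    then show ?thesis using * by (auto simp: d_def elim: eventually_mono)
  qed
  have ev: "\<forall>\<^sub>F n in sequentially. T \<subseteq> {..n} \<and>
      (\<forall>i\<in>T. \<forall>j\<in>T. before (d n) (e i) (e j) \<longleftrightarrow> lt i j)" if "finite T" for T
  proof (rule eventually_conj)
    obtain N where "T \<subseteq> {..N}" using \<open>finite T\<close> finite_nat_iff_bounded_le by auto
    then show "\<forall>\<^sub>F n in sequentially. T \<subseteq> {..n}"
      by (intro eventually_sequentiallyI[of N]) auto
    show "\<forall>\<^sub>F n in sequentially. \<forall>i\<in>T. \<forall>j\<in>T. before (d n) (e i) (e j) \<longleftrightarrow> lt i j"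
      using that ev1 by (intro eventually_ball_finite ballI)
  qed
  \<comment> \<open>Transfer principle: a property holding infinitely often meets the eventual
    agreement on \<open>T\<close> at some \<open>n\<close>, and \<open>f\<close> gives the positions
    on that cycle.\<close>
  have agree: "\<exists>n f. Q n \<and> (\<forall>i\<in>T. f i < length (d n) \<and> d n ! f i = e i) \<and>
      (\<forall>i\<in>T. \<forall>j\<in>T. lt i j \<longleftrightarrow> f i < f j)"
    if T: "finite T" and Q: "\<exists>\<^sub>F n in sequentially. Q n" for T Q
  proof -
    obtain n where n: "Q n" "T \<subseteq> {..n}" "\<forall>i\<in>T. \<forall>j\<in>T. before (d n) (e i) (e j) \<longleftrightarrow> lt i j"
      using frequently_ex[OF frequently_eventually_frequently[OF Q ev[OF T]]] by blast
    then have "\<forall>i\<in>T. \<exists>m < length (d n). d n ! m = e i" using d_index by blast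
    then obtain f where f: "\<forall>i\<in>T. f i < length (d n) \<and> d n ! f i = e i" by metis
    then have "\<forall>i\<in>T. \<forall>j\<in>T. lt i j \<longleftrightarrow> f i < f j"
      using n(3) before_nth[OF d_dist] by metis
    then show ?thesis using n(1) f by blast
  qed
  have agree': "\<exists>n f. (\<forall>i\<in>T. f i < length (d n) \<and> d n ! f i = e i) \<and>
      (\<forall>i\<in>T. \<forall>j\<in>T. lt i j \<longleftrightarrow> f i < f j)" if "finite T" for T
    using agree[OF that, of "\<lambda>_. True"] by (simp add: frequently_const)
  \<comment> \<open>The second disjunct is the closing edge, since every \<open>d n\<close> starts
    at \<open>e 0\<close>.\<close>
  define adjacent_in where "adjacent_in n i j \<longleftrightarrow>
      (\<exists>m. Suc m < length (d n) \<and> d n ! m = e i \<and> d n ! Suc m = e j) \<or> j = 0 \<and> last (d n) = e i" for n i j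
  have followsI: "follows lt i j" if fr: "\<exists>\<^sub>F n in sequentially. adjacent_in n i j" for i j
  proof -
    consider (1) "\<exists>\<^sub>F n in sequentially. \<exists>m. Suc m < length (d n) \<and> d n ! m = e i \<and> d n ! Suc m = e j"
      | (2) "j = 0" "\<exists>\<^sub>F n in sequentially. last (d n) = e i"
      using fr unfolding adjacent_in_def frequently_disj_iff by (auto elim: frequently_mono)
    then show ?thesis
    proof cases
      case 1
      have "lt l j \<longleftrightarrow> l = i \<or> lt l i" for l
      proof -
        obtain n f m where n: "Suc m < length (d n)" "d n ! m = e i" "d n ! Suc m = e j"
          and f: "\<forall>x\<in>{i,j,l}. f x < length (d n) \<and> d n ! f x = e x"
            "\<forall>x\<in>{i,j,l}. \<forall>y\<in>{i,j,l}. lt x y \<longleftrightarrow> f x < f y"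
          using agree[OF _ 1, of "{i,j,l}"] by auto
        have "f i = m" "f j = Suc m"
          using n f(1) nth_eq_iff_index_eq[OF d_dist, of _ n] by (metis insertCI Suc_lessD)+
        moreover have "l = i \<longleftrightarrow> f l = f i"
          using f(1) by (metis e_inj insertCI)
        ultimately show ?thesis using f(2) by auto
      qed
      then show ?thesis by (simp add: follows_def)
    next
      case 2
      have "lt l i" if "l \<noteq> i" for l
      proof -
        obtain n f where n: "last (d n) = e i"
          and f: "\<forall>x\<in>{i,l}. f x < length (d n) \<and> d n ! f x = e x"
            "\<forall>x\<in>{i,l}. \<forall>y\<in>{i,l}. lt x y \<longleftrightarrow> f x < f y"
          using agree[OF _ 2(2), of "{i,l}"] by auto
        have "d n \<noteq> []" using d_len[of n] by auto
        then have "d n ! (length (d n) - 1) = e i" using n by (simp add: last_conv_nth)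
        then have "f i = length (d n) - 1"
          using f(1) nth_eq_iff_index_eq[OF d_dist, of _ n] \<open>d n \<noteq> []\<close>
          by (metis insertCI diff_less length_greater_0_conv zero_less_one)
        moreover have "f l \<noteq> f i" using that f(1) by (metis e_inj insertCI)
        ultimately have "f l < f i" using f(1) by fastforce
        then show ?thesis using f(2) by simp
      qed
      then show ?thesis using 2(1) by (simp add: follows_def)
    qed
  qed
  have fin_J: "finite {j. {e i, e j} \<in> E}" for i
  proof -
    have "finite (nbhd E (e i))" using locfin e_V by (simp add: locally_finite_graph_def)
    moreover have "inj e" using bij by (simp add: bij_betw_def)
    ultimately have "finite (e -` nbhd E (e i))" by (rule finite_vimageI)
    then show ?thesis by (simp add: vimage_def nbhd_def)
  qed
  \<comment> \<open>Applied to the finite set of neighbours, which is where local finiteness keeps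
    an edge in the limit.\<close>
  have pigeon: "\<exists>j\<in>J. \<exists>\<^sub>F n in sequentially. Q n j"
    if "finite J" and *: "\<And>n. n \<ge> i \<Longrightarrow> \<exists>j\<in>J. Q n j" for J :: "nat set" and Q and i :: nat
  proof -
    have "\<forall>\<^sub>F n in sequentially. \<exists>j\<in>J. Q n j"
      using * by (rule eventually_sequentiallyI)
    then have "\<exists>\<^sub>F n in sequentially. \<exists>j\<in>J. Q n j"
      by (rule eventually_frequently[rotated]) simp
    then show ?thesis using frequently_bex_finite_distrib[OF that(1)] by blast
  qed
  have edge_Suc: "{d n ! m, d n ! Suc m} \<in> E" if "Suc m < length (d n)" for n m
    using d_cycle[of n] that successively_nth[of _ "d n" m] unfolding is_cycle_def by blast
  have edge_last: "{last (d n), e 0} \<in> E" for n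
    using d_cycle[of n] c(3)[of "k n"] unfolding is_cycle_def d_def by simp
  have succ: "\<exists>j. {e i, e j} \<in> E \<and> follows lt i j" for i
  proof -
    have "\<exists>j\<in>{j. {e i, e j} \<in> E}. adjacent_in n i j" if n: "n \<ge> i" for n
    proof -
      obtain m where m: "m < length (d n)" "d n ! m = e i" using d_index[OF n] by blast
      show ?thesis
      proof (cases "Suc m < length (d n)")
        case True
        obtain j where "d n ! Suc m = e j" using d_inverse[OF True] by blast
        then have "{e i, e j} \<in> E" "adjacent_in n i j"
          using edge_Suc[OF True] True m unfolding adjacent_in_def by auto
        then show ?thesis by blast
      next
        case False
        then have "Suc m = length (d n)" using m(1) by simp
        then have "last (d n) = e i" using m(2) by (metis diff_Suc_1 last_conv_nth length_0_conv nat.distinct(1))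
        then have "{e i, e 0} \<in> E" "adjacent_in n i 0"
          using edge_last[of n] unfolding adjacent_in_def by auto
        then show ?thesis by blast
      qed
    qed
    then have "\<exists>j\<in>{j. {e i, e j} \<in> E}. \<exists>\<^sub>F n in sequentially. adjacent_in n i j"
      by (rule pigeon[OF fin_J])
    then show ?thesis using followsI by blast
  qed
  have pred: "\<exists>j. {e j, e i} \<in> E \<and> follows lt j i" for i
  proof -
    have "\<exists>j\<in>{j. {e i, e j} \<in> E}. adjacent_in n j i" if n: "n \<ge> i" for n
    proof -
      obtain m where m: "m < length (d n)" "d n ! m = e i" using d_index[OF n] by blast
      show ?thesis
      proof (cases m)
        case (Suc m')
        then obtain j where "d n ! m' = e j" using d_inverse[of m' n] m(1) by auto
        then have "{e i, e j} \<in> E" "adjacent_in n j i"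
          using edge_Suc[of m' n] Suc m unfolding adjacent_in_def by (auto simp: insert_commute)
        then show ?thesis by blast
      next
        case 0
        then have "i = 0" using m(2) d_hd e_inj by simp
        have "d n \<noteq> []" using m(1) by auto
        then obtain j where "last (d n) = e j"
          using d_inverse[of "length (d n) - 1" n] m(1) by (auto simp: last_conv_nth)
        then have "{e i, e j} \<in> E" "adjacent_in n j i"
          using edge_last[of n] \<open>i = 0\<close> unfolding adjacent_in_def by (auto simp: insert_commute)
        then show ?thesis by blast
      qed
    qed
    then have "\<exists>j\<in>{j. {e i, e j} \<in> E}. \<exists>\<^sub>F n in sequentially. adjacent_in n j i"
      by (rule pigeon[OF fin_J])
    then show ?thesis using followsI by (auto simp: insert_commute)
  qed
  have "vertex_order V E e lt"
  proof
    show "simple_graph V E" "bij_betw e UNIV V" by fact+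
    show "\<not> lt i i" for i
      using agree'[of "{i}"] by auto
    show "lt i k" if "lt i j" "lt j k" for i j k
    proof -
      obtain f where "\<forall>x\<in>{i,j,k}. \<forall>y\<in>{i,j,k}. lt x y \<longleftrightarrow> f x < (f y :: nat)"
        using agree'[of "{i,j,k}"] by auto
      then show ?thesis using that by auto
    qed
    show "lt i j \<or> lt j i" if "i \<noteq> j" for i j
    proof -
      obtain n f where f: "\<forall>x\<in>{i,j}. f x < length (d n) \<and> d n ! f x = e x"
        "\<forall>x\<in>{i,j}. \<forall>y\<in>{i,j}. lt x y \<longleftrightarrow> f x < f y"
        using agree'[of "{i,j}"] by auto
      have "f i \<noteq> f j" using f(1) that by (metis e_inj insertCI)
      then show ?thesis using f(2) by auto
    qed
    show "lt 0 i" if "i \<noteq> 0" for i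
    proof -
      obtain n f where f: "\<forall>x\<in>{0,i}. f x < length (d n) \<and> d n ! f x = e x"
        "\<forall>x\<in>{0,i}. \<forall>y\<in>{0,i}. lt x y \<longleftrightarrow> f x < f y"
        using agree'[of "{0,i}"] by auto
      have "f i \<noteq> 0" using f(1) that d_hd[of n] by (metis e_inj insertCI)
      moreover have "d n \<noteq> []" using d_len[of n] by auto
      then have "f 0 = 0"
        using f(1) d_hd[of n] nth_eq_iff_index_eq[OF d_dist, of "f 0" n 0] \<open>d n \<noteq> []\<close> by auto
      ultimately show ?thesis using f(2) by auto
    qed
    show "\<exists>j. {e i, e j} \<in> E \<and> follows lt i j" "\<exists>j. {e j, e i} \<in> E \<and> follows lt j i" for i
      using succ pred by blast+
    show "(e a, e b) \<in> reach_on E (V - e ` S)"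
      if "lt a b" "finite S" and S: "\<And>s. s \<in> S \<Longrightarrow> lt s a \<or> lt b s" for a b S
    proof -
      obtain n f where f: "\<forall>x\<in>{a,b} \<union> S. f x < length (d n) \<and> d n ! f x = e x"
        "\<forall>x\<in>{a,b} \<union> S. \<forall>y\<in>{a,b} \<union> S. lt x y \<longleftrightarrow> f x < f y"
        using agree'[of "{a,b} \<union> S"] \<open>finite S\<close> by auto
      have ab: "f a < f b" using f(2) \<open>lt a b\<close> by auto
      \<comment> \<open>The segment of one cycle from \<open>a\<close> to \<open>b\<close> serves as
        the walk. It may leave the interval of the limit order, but it avoids \<open>S\<close>
        because the order on \<open>S\<close> is already realised.\<close>
      have in_X: "d n ! m \<in> V - e ` S" if "f a \<le> m" "m \<le> f b" for m
      proof -
        have m: "m < length (d n)" using f(1) that by (meson UnI1 insertCI order.strict_trans1)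
        have "d n ! m \<noteq> e s" if "s \<in> S" for s
        proof
          assume "d n ! m = e s"
          then have "m = f s"
            using f(1) \<open>s \<in> S\<close> m nth_eq_iff_index_eq[OF d_dist] by (metis UnI2)
          moreover have "f s < f a \<or> f b < f s" using S[OF \<open>s \<in> S\<close>] f(2) \<open>s \<in> S\<close> by blast
          ultimately show False using \<open>f a \<le> m\<close> \<open>m \<le> f b\<close> by simp
        qed
        then show ?thesis using d_V[OF m] by auto
      qed
      have "(d n ! f a, d n ! m) \<in> (adj_on E (V - e ` S))\<^sup>*" if "f a \<le> m" "m \<le> f b" for m
        using that
      proof (induction m rule: dec_induct)
        case (step m)
        have "Suc m < length (d n)" using f(1) step by (meson UnI1 insertCI order.strict_trans1)
        then have "(d n ! m, d n ! Suc m) \<in> adj_on E (V - e ` S)"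
          using edge_Suc in_X[of m] in_X[of "Suc m"] step by (simp add: adj_on_def)
        with step show ?case by (auto intro: rtrancl.rtrancl_into_rtrancl)
      qed simp
      from this[of "f b"] show ?thesis
        using ab f(1) in_X[of "f a"] in_X[of "f b"] by (auto simp: reach_on_def)
    qed
  qed
  then show thesis using that by blast
qed

section \<open>Rays\<close>

lemma reach_on_refl: "x \<in> X \<Longrightarrow> (x, x) \<in> reach_on E X"
  by (simp add: reach_on_def)

lemma reach_on_sym: "(x, y) \<in> reach_on E X \<Longrightarrow> (y, x) \<in> reach_on E X"
  using equiv_reach_on[of X E] by (meson equiv_def symD)

lemma reach_on_trans: "(x, y) \<in> reach_on E X \<Longrightarrow> (y, z) \<in> reach_on E X \<Longrightarrow> (x, z) \<in> reach_on E X"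
  using equiv_reach_on[of X E] by (meson equiv_def transD)

lemma reach_on_mono: "X \<subseteq> Y \<Longrightarrow> (x, y) \<in> reach_on E X \<Longrightarrow> (x, y) \<in> reach_on E Y"
  unfolding reach_on_def adj_on_def
  using rtrancl_mono[of "{(x, y). x \<in> X \<and> y \<in> X \<and> {x, y} \<in> E}" "{(x, y). x \<in> Y \<and> y \<in> Y \<and> {x, y} \<in> E}"]
  by blast

lemma reach_on_edge: "x \<in> X \<Longrightarrow> y \<in> X \<Longrightarrow> {x, y} \<in> E \<Longrightarrow> (x, y) \<in> reach_on E X"
  by (auto simp: reach_on_def adj_on_def)

lemma component_closed:
  assumes "C \<in> graph_components E X" "x \<in> C" "(x, y) \<in> reach_on E X"
  shows "y \<in> C"
  using assms quotient_eqI[OF equiv_reach_on[of X E], of C C x y] equiv_reach_on[of X E]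
  unfolding graph_components_def by (metis equiv_class_eq_iff in_quotient_imp_closed)

lemma component_subset: "C \<in> graph_components E X \<Longrightarrow> C \<subseteq> X"
  using in_quotient_imp_subset[OF equiv_reach_on[of X E]] by (auto simp: graph_components_def)

lemma component_unique:
  assumes "C \<in> graph_components E X" "D \<in> graph_components E X" "x \<in> C" "x \<in> D"
  shows "C = D"
  using assms quotient_disj[OF equiv_reach_on] unfolding graph_components_def by blast

lemma reach_on_walk:
  assumes "(x, y) \<in> reach_on E X"
  shows "\<exists>xs. xs \<noteq> [] \<and> hd xs = x \<and> last xs = y \<and> successively (\<lambda>a b. {a, b} \<in> E) xs \<and>
    set xs \<subseteq> reach_on E X `` {x}"
proof -
  have "(x, y) \<in> (adj_on E X)\<^sup>*" and x: "x \<in> X" using assms by (auto simp: reach_on_def)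
  then show ?thesis
  proof (induction)
    case base
    then show ?case using reach_on_refl[OF x] by (intro exI[of _ "[x]"]) auto
  next
    case (step y z)
    then obtain xs where xs: "xs \<noteq> []" "hd xs = x" "last xs = y"
      "successively (\<lambda>a b. {a, b} \<in> E) xs" "set xs \<subseteq> reach_on E X `` {x}" by blast
    have yz: "y \<in> X" "z \<in> X" "{y, z} \<in> E" using step by (auto simp: adj_on_def)
    have "y \<in> set xs" using xs(1,3) by auto
    then have "(x, y) \<in> reach_on E X" using xs(5) by blast
    then have "(x, z) \<in> reach_on E X" using reach_on_trans reach_on_edge[OF yz] by metis
    then show ?case using xs yz
      by (intro exI[of _ "xs @ [z]"]) (auto simp: successively_append_iff)
  qed
qed

text \<open>Loop erasure by last exits: \<open>\<iota>\<close> jumps from a vertex to the successor of its last visit.\<close>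

lemma loop_erasure:
  fixes w :: "nat \<Rightarrow> 'a"
  assumes step: "\<And>m. w (Suc m) = w m \<or> {w m, w (Suc m)} \<in> E"
    and fin: "\<And>m. finite {l. w l = w m}"
  obtains \<iota> where "strict_mono \<iota>" "inj (w \<circ> \<iota>)" "\<And>k. {w (\<iota> k), w (\<iota> (Suc k))} \<in> E"
proof -
  define exit where "exit m = Max {l. w l = w m}" for m
  have w_exit: "w (exit m) = w m" for m
    using Max_in[OF fin[of m]] by (auto simp: exit_def)
  have exit_ge: "l \<le> exit m" if "w l = w m" for l m
    using Max_ge[OF fin[of m], of l] that by (simp add: exit_def)
  define \<iota> where "\<iota> = rec_nat (exit 0) (\<lambda>_ i. exit (Suc i))"
  have \<iota>_Suc: "\<iota> (Suc k) = exit (Suc (\<iota> k))" for k by (simp add: \<iota>_def)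
  have \<iota>_exit: "\<exists>m. \<iota> k = exit m" for k by (cases k) (auto simp: \<iota>_def)
  have last: "l \<le> \<iota> k" if "w l = w (\<iota> k)" for l k
    using \<iota>_exit[of k] exit_ge[of l] w_exit that by metis
  have mono: "strict_mono \<iota>"
    unfolding strict_mono_Suc_iff \<iota>_Suc using exit_ge[OF refl] by (metis Suc_le_lessD)
  moreover have "inj (w \<circ> \<iota>)"
  proof (rule injI)
    fix k l assume "(w \<circ> \<iota>) k = (w \<circ> \<iota>) l"
    then have "\<iota> k = \<iota> l" using last[of "\<iota> k" l] last[of "\<iota> l" k] by simp
    then show "k = l" using mono by (simp add: strict_mono_eq)
  qed
  moreover have "{w (\<iota> k), w (\<iota> (Suc k))} \<in> E" for k
    using step[of "\<iota> k"] last[of "Suc (\<iota> k)" k] w_exit[of "Suc (\<iota> k)"] by (auto simp: \<iota>_Suc)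
  ultimately show thesis using that by blast
qed

text \<open>A state holds the current stage and the unread rest of its walk. Passing to the next
  stage reads the shared end vertex twice, hence the alternative
  \<open>w (Suc m) = w m\<close>.\<close>

lemma concatenated_walk:
  assumes walk: "\<And>n. W n \<noteq> []" "\<And>n. last (W n) = hd (W (Suc n))"
    "\<And>n. successively (\<lambda>a b. {a, b} \<in> E) (W n)"
  obtains w where "\<And>m. w (Suc m) = w m \<or> {w m, w (Suc m)} \<in> E"
    "\<And>n. \<exists>M. \<forall>m\<ge>M. \<exists>k\<ge>n. w m \<in> set (W k)" "\<And>m. \<exists>k. w m \<in> set (W k)"
proof -
  define st where "st = rec_nat (0, W 0)
    (\<lambda>_ (n, xs). if tl xs = [] then (Suc n, W (Suc n)) else (n, tl xs))"
  define w where "w m = hd (snd (st m))" for m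
  have st_Suc: "st (Suc m) = (if tl (snd (st m)) = []
      then (Suc (fst (st m)), W (Suc (fst (st m)))) else (fst (st m), tl (snd (st m))))" for m
    by (simp add: st_def case_prod_beta)
  have inv: "snd (st m) \<noteq> [] \<and> last (snd (st m)) = hd (W (Suc (fst (st m)))) \<and>
      successively (\<lambda>a b. {a, b} \<in> E) (snd (st m)) \<and> set (snd (st m)) \<subseteq> set (W (fst (st m)))" for m
  proof (induction m)
    case 0
    then show ?case using walk by (simp add: st_def)
  next
    case (Suc m)
    obtain x xs where "snd (st m) = x # xs" using Suc by (cases "snd (st m)") auto
    with Suc show ?case
      using walk by (auto simp: st_Suc successively_Cons)
  qed
  have "w (Suc m) = w m \<or> {w m, w (Suc m)} \<in> E" for m
  proof -
    obtain x xs where "snd (st m) = x # xs" using inv[of m] by (cases "snd (st m)") auto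
    then show ?thesis using inv[of m] by (auto simp: w_def st_Suc successively_Cons)
  qed
  moreover have "\<exists>M. \<forall>m\<ge>M. \<exists>k\<ge>n. w m \<in> set (W k)" for n
  proof -
    have next_stage: "\<exists>m'. fst (st m') = Suc (fst (st m))" for m
    proof (induction "length (snd (st m))" arbitrary: m rule: less_induct)
      case less
      show ?case
      proof (cases "tl (snd (st m)) = []")
        case True
        then have "fst (st (Suc m)) = Suc (fst (st m))" by (simp add: st_Suc)
        then show ?thesis by blast
      next
        case False
        then have "st (Suc m) = (fst (st m), tl (snd (st m)))" by (simp add: st_Suc)
        then show ?thesis using less[of "Suc m"] inv[of m] by (cases "snd (st m)") auto
      qed
    qed
    have "\<exists>M. fst (st M) = n"
    proof (induction n)
      case 0
      show ?case by (intro exI[of _ 0]) (simp add: st_def)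
    qed (use next_stage in metis)
    then obtain M where M: "fst (st M) = n" by blast
    have mono: "incseq (\<lambda>m. fst (st m))"
      by (intro incseq_SucI) (simp add: st_Suc)
    have "\<exists>k\<ge>n. w m \<in> set (W k)" if "m \<ge> M" for m
    proof (intro exI conjI)
      show "n \<le> fst (st m)" using incseqD[OF mono that] M by simp
      show "w m \<in> set (W (fst (st m)))" using inv[of m] by (auto simp: w_def)
    qed
    then show ?thesis by blast
  qed
  moreover have "\<exists>k. w m \<in> set (W k)" for m
    using inv[of m] hd_in_set unfolding w_def by blast
  ultimately show thesis using that by blast
qed

text \<open>Concatenated walks from \<open>x n\<close> to \<open>x (Suc n)\<close> inside
  \<open>X n\<close> eventually stay in the component of \<open>x n\<close>. As the sets have empty
  intersection, every vertex is visited finitely often, so loops can be erased to leave a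
  ray.\<close>

lemma ray_in_decreasing_sets:
  assumes dec: "\<And>n. X (Suc n) \<subseteq> X n" and inter: "(\<Inter>n. X n) = {}" and V: "X 0 \<subseteq> V"
    and reach: "\<And>n. (x n, x (Suc n)) \<in> reach_on E (X n)"
  obtains r where "ray V E r" "\<And>n. \<exists>m. \<forall>k\<ge>m. (x n, r k) \<in> reach_on E (X n)"
proof -
  have X_mono: "X k \<subseteq> X n" if "n \<le> k" for n k
    using lift_Suc_antimono_le[of X, OF dec that] .
  have x_reach: "(x n, x k) \<in> reach_on E (X n)" if "n \<le> k" for n k
    using that
  proof (induction k rule: dec_induct)
    case base
    show ?case using reach[of n] by (intro reach_on_refl) (auto simp: reach_on_def)
  next
    case (step k)
    then show ?case
      using reach_on_trans reach_on_mono[OF X_mono reach, of n k] by (metis less_imp_le_nat)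
  qed
  have "\<exists>xs. xs \<noteq> [] \<and> hd xs = x n \<and> last xs = x (Suc n) \<and>
      successively (\<lambda>a b. {a, b} \<in> E) xs \<and> set xs \<subseteq> reach_on E (X n) `` {x n}" for n
    using reach_on_walk[OF reach] .
  then obtain W where W: "\<And>n. W n \<noteq> []" "\<And>n. hd (W n) = x n" "\<And>n. last (W n) = x (Suc n)"
    "\<And>n. successively (\<lambda>a b. {a, b} \<in> E) (W n)" "\<And>n. set (W n) \<subseteq> reach_on E (X n) `` {x n}"
    by metis
  obtain w where w: "\<And>m. w (Suc m) = w m \<or> {w m, w (Suc m)} \<in> E"
    "\<And>n. \<exists>M. \<forall>m\<ge>M. \<exists>k\<ge>n. w m \<in> set (W k)" "\<And>m. \<exists>k. w m \<in> set (W k)"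
    using concatenated_walk[of W E] W by metis
  have tail: "\<exists>M. \<forall>m\<ge>M. (x n, w m) \<in> reach_on E (X n)" for n
  proof -
    obtain M where M: "\<forall>m\<ge>M. \<exists>k\<ge>n. w m \<in> set (W k)" using w(2) by blast
    have "(x n, w m) \<in> reach_on E (X n)" if m: "m \<ge> M" for m
    proof -
      obtain k where k: "k \<ge> n" "w m \<in> set (W k)" using M m by blast
      then have "(x k, w m) \<in> reach_on E (X k)" using W(5) by blast
      then show ?thesis
        using reach_on_trans[OF x_reach[OF k(1)]] reach_on_mono[OF X_mono[OF k(1)]] by metis
    qed
    then show ?thesis by blast
  qed
  have all_V: "w m \<in> V" for m
  proof -
    obtain k where "w m \<in> set (W k)" using w(3) by blast
    then have "w m \<in> X k" using W(5)[of k] by (auto simp: reach_on_def)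
    then show ?thesis using X_mono[of 0 k] V by auto
  qed
  have fin: "finite {l. w l = w m}" for m
  proof -
    obtain n where n: "w m \<notin> X n" using inter by blast
    obtain M where M: "\<forall>l\<ge>M. (x n, w l) \<in> reach_on E (X n)" using tail by blast
    have "{l. w l = w m} \<subseteq> {..<M}"
    proof
      fix l assume "l \<in> {l. w l = w m}"
      then have "(x n, w l) \<notin> reach_on E (X n)" using n by (auto simp: reach_on_def)
      then show "l \<in> {..<M}" using M by (metis lessThan_iff not_le)
    qed
    then show ?thesis by (rule finite_subset) simp
  qed
  obtain \<iota> where \<iota>: "strict_mono \<iota>" "inj (w \<circ> \<iota>)" "\<And>k. {w (\<iota> k), w (\<iota> (Suc k))} \<in> E"
    using loop_erasure[OF w(1) fin] by blast
  have "ray V E (w \<circ> \<iota>)" using \<iota> all_V by (auto simp: ray_def)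
  moreover have "\<exists>m. \<forall>k\<ge>m. (x n, (w \<circ> \<iota>) k) \<in> reach_on E (X n)" for n
    using tail[of n] strict_mono_imp_increasing[OF \<iota>(1)] by (metis comp_apply le_trans)
  ultimately show thesis using that by blast
qed

section \<open>Placing the vertices on the unit interval\<close>

definition weight :: "nat \<Rightarrow> real" where
  "weight i = (1/2) ^ Suc i"

definition mass :: "nat set \<Rightarrow> real" where
  "mass A = (\<Sum>i. if i \<in> A then weight i else 0)"

lemma weight_pos: "0 < weight i"
  by (simp add: weight_def)

lemma weight_sums: "weight sums 1"
  unfolding weight_def using power_half_series .

lemma mass_summable: "summable (\<lambda>i. if i \<in> A then weight i else 0)"
  by (rule summable_comparison_test'[OF sums_summable[OF weight_sums], of 0])
    (simp add: weight_pos less_imp_le)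

lemma mass_UNIV: "mass UNIV = 1"
  unfolding mass_def using weight_sums by (simp add: sums_iff)

lemma mass_empty: "mass {} = 0"
  by (simp add: mass_def)

lemma mass_Un_disjoint:
  assumes "A \<inter> B = {}"
  shows "mass (A \<union> B) = mass A + mass B"
proof -
  have "mass A + mass B =
      (\<Sum>i. (if i \<in> A then weight i else 0) + (if i \<in> B then weight i else 0))"
    unfolding mass_def by (rule suminf_add[OF mass_summable mass_summable])
  also have "\<dots> = mass (A \<union> B)"
    unfolding mass_def using assms by (intro suminf_cong) auto
  finally show ?thesis ..
qed

lemma mass_nonneg: "0 \<le> mass A"
  unfolding mass_def by (intro suminf_nonneg mass_summable) (simp add: weight_pos less_imp_le)

lemma mass_mono: "A \<subseteq> B \<Longrightarrow> mass A \<le> mass B"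
  using mass_Un_disjoint[of A "B - A"] mass_nonneg[of "B - A"] by (simp add: Un_absorb1)

lemma mass_insert: "i \<notin> A \<Longrightarrow> mass (insert i A) = mass A + weight i"
proof -
  have "mass {i} = (\<Sum>j\<in>{i}. if j \<in> {i} then weight j else 0)"
    unfolding mass_def by (rule suminf_finite) auto
  then show "i \<notin> A \<Longrightarrow> mass (insert i A) = mass A + weight i"
    using mass_Un_disjoint[of A "{i}"] by simp
qed

text \<open>Reduces a bound to finite sets, which have first and last elements in the vertex order
  while infinite sets need not.\<close>

lemma mass_le_if_finite_subsets:
  assumes "\<And>F. finite F \<Longrightarrow> F \<subseteq> A \<Longrightarrow> mass F \<le> c"
  shows "mass A \<le> c"
  unfolding mass_def
proof (rule suminf_le_const[OF mass_summable])
  fix n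
  have "mass (A \<inter> {..<n}) = (\<Sum>i<n. if i \<in> A \<inter> {..<n} then weight i else 0)"
    unfolding mass_def by (rule suminf_finite) auto
  also have "\<dots> = (\<Sum>i<n. if i \<in> A then weight i else 0)"
    by (intro sum.cong) auto
  finally show "(\<Sum>i<n. if i \<in> A then weight i else 0) \<le> c"
    using assms[of "A \<inter> {..<n}"] by simp
qed

context vertex_order
begin

definition pos :: "nat \<Rightarrow> real" where
  "pos i = mass {j. lt j i}"

definition pos_end :: "nat \<Rightarrow> real" where
  "pos_end i = pos i + weight i"

lemma pos_end_mass: "pos_end i = mass (insert i {j. lt j i})"
  unfolding pos_end_def pos_def by (rule mass_insert[symmetric]) (simp add: lt_irrefl)

lemma pos_less_pos_end: "pos i < pos_end i"
  by (simp add: pos_end_def weight_pos)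

lemma pos_nonneg: "0 \<le> pos i"
  by (simp add: pos_def mass_nonneg)

lemma pos_end_le_1: "pos_end i \<le> 1"
  unfolding pos_end_mass mass_UNIV[symmetric] by (rule mass_mono) simp

lemma pos_end_le_pos: "lt i j \<Longrightarrow> pos_end i \<le> pos j"
  unfolding pos_end_mass unfolding pos_def by (rule mass_mono) (auto intro: lt_trans)

lemma pos_less_iff: "pos i < pos j \<longleftrightarrow> lt i j"
  using lt_total[of i j] lt_irrefl pos_end_le_pos[of i j] pos_end_le_pos[of j i]
    pos_less_pos_end[of i] pos_less_pos_end[of j] by fastforce

lemma pos_zero: "pos 0 = 0"
proof -
  have "\<not> lt j 0" for j
    using lt_zero[of j] lt_trans[of 0 j 0] lt_irrefl[of 0] by (cases "j = 0") auto
  then show ?thesis by (simp add: pos_def mass_empty)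
qed

lemma pos_eq_iff: "pos i = pos j \<longleftrightarrow> i = j"
  using lt_total[of i j] pos_less_iff[of i j] pos_less_iff[of j i] by auto

lemma intervals_disjoint: "pos i \<le> t \<Longrightarrow> t < pos_end i \<Longrightarrow> pos j \<le> t \<Longrightarrow> t < pos_end j \<Longrightarrow> i = j"
  using lt_total[of i j] pos_end_le_pos[of i j] pos_end_le_pos[of j i] by linarith

text \<open>The predecessors of \<open>j\<close> are \<open>i\<close> and the predecessors of
  \<open>i\<close>, so consecutive intervals abut; after the last vertex all mass is used up and the
  order wraps round to index 0.\<close>

lemma follows_pos:
  assumes "follows lt i j"
  shows "j \<noteq> 0 \<and> pos j = pos_end i \<or> j = 0 \<and> pos_end i = 1"
proof -
  consider "\<forall>l. lt l j \<longleftrightarrow> l = i \<or> lt l i" | "j = 0" "\<forall>l. l \<noteq> i \<longrightarrow> lt l i"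
    using assms unfolding follows_def by blast
  then show ?thesis
  proof cases
    case 1
    then have "{l. lt l j} = insert i {l. lt l i}" by blast
    moreover have "j \<noteq> 0" using 1 lt_zero lt_trans lt_irrefl by metis
    ultimately show ?thesis by (simp add: pos_end_mass pos_def)
  next
    case 2
    then have "insert i {l. lt l i} = UNIV" by blast
    then show ?thesis using 2(1) mass_UNIV by (simp add: pos_end_mass)
  qed
qed

text \<open>Otherwise every interval ends by \<open>a\<close> or starts from \<open>b\<close> on.
  The former have total length at most \<open>a\<close>, the latter at most \<open>1 - b\<close>,
  too little for total mass 1.\<close>

lemma intervals_dense:
  assumes "0 \<le> a" "a < b" "b \<le> 1"
  shows "\<exists>i. pos i < b \<and> a < pos_end i"
proof (rule ccontr)
  assume none: "\<not> ?thesis"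
  have *: "pos_end i \<le> a \<or> b \<le> pos i" for i
    using none not_le by blast
  define A where "A = {i. pos_end i \<le> a}"
  have "mass A \<le> a"
  proof (rule mass_le_if_finite_subsets)
    fix F assume F: "finite F" "F \<subseteq> A"
    show "mass F \<le> a"
    proof (cases "F = {}")
      case False
      then have "Max (pos ` F) \<in> pos ` F" using F(1) by (intro Max_in) auto
      then obtain m where m: "m \<in> F" "pos m = Max (pos ` F)" by auto
      have "i = m \<or> lt i m" if "i \<in> F" for i
      proof -
        have "pos i \<le> pos m" using F(1) that m(2) by simp
        then show ?thesis using pos_less_iff[of i m] pos_eq_iff[of i m] by linarith
      qed
      then have "F \<subseteq> insert m {j. lt j m}" by blast
      then have "mass F \<le> pos_end m" unfolding pos_end_mass by (rule mass_mono)
      then show ?thesis using m(1) F(2) by (auto simp: A_def)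
    qed (simp add: mass_empty assms)
  qed
  moreover have "mass (- A) \<le> 1 - b"
  proof (rule mass_le_if_finite_subsets)
    fix F assume F: "finite F" "F \<subseteq> - A"
    show "mass F \<le> 1 - b"
    proof (cases "F = {}")
      case False
      then have "Min (pos ` F) \<in> pos ` F" using F(1) by (intro Min_in) auto
      then obtain m where m: "m \<in> F" "pos m = Min (pos ` F)" by auto
      have "\<not> lt i m" if "i \<in> F" for i
        using F(1) that m(2) by (simp flip: pos_less_iff add: not_less)
      then have "F \<inter> {j. lt j m} = {}" by blast
      then have "mass F + pos m = mass (F \<union> {j. lt j m})"
        by (simp add: mass_Un_disjoint pos_def)
      also have "\<dots> \<le> 1" unfolding mass_UNIV[symmetric] by (rule mass_mono) simp
      finally have "mass F + pos m \<le> 1" .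
      moreover have "b \<le> pos m" using m(1) F(2) *[of m] by (auto simp: A_def)
      ultimately show ?thesis by simp
    qed (simp add: mass_empty assms)
  qed
  moreover have "mass A + mass (- A) = 1"
    using mass_Un_disjoint[of A "- A"] mass_UNIV by simp
  ultimately show False using assms by linarith
qed

text \<open>The parameter 1 is left out because it is identified with 0, the position of the first
  vertex.\<close>

definition gap :: "real \<Rightarrow> bool" where
  "gap t \<longleftrightarrow> 0 \<le> t \<and> t < 1 \<and> (\<forall>i. \<not> (pos i \<le> t \<and> t < pos_end i))"

lemma gap_pos_neq: "gap t \<Longrightarrow> pos i \<noteq> t"
  using pos_less_pos_end[of i] by (auto simp: gap_def)

text \<open>An interval reaching close to \<open>t\<close> from the left may start far away; its
  right end is the position of the next vertex, which is taken instead. On the right the start of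
  the interval itself serves.\<close>

lemma gap_approx_left:
  assumes "gap t" "0 < \<delta>"
  shows "\<exists>i. t - \<delta> < pos i \<and> pos i < t"
proof -
  have t: "0 < t" "t < 1" using assms(1) gap_pos_neq[of t 0] by (auto simp: gap_def pos_zero)
  obtain i where i: "pos i < t" "max 0 (t - \<delta>) < pos_end i"
    using intervals_dense[of "max 0 (t - \<delta>)" t] t assms(2) by auto
  have "\<not> (pos i \<le> t \<and> t < pos_end i)" using assms(1) unfolding gap_def by blast
  then have "pos_end i \<le> t" using i(1) by linarith
  moreover obtain j where "follows lt i j" using succ_exists by blast
  ultimately have "pos j = pos_end i" using follows_pos[of i j] t by auto
  then show ?thesis
    using i \<open>pos_end i \<le> t\<close> gap_pos_neq[OF assms(1), of j] by (intro exI[of _ j]) auto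
qed

lemma gap_approx_right:
  assumes "gap t" "0 < \<delta>"
  shows "\<exists>i. t < pos i \<and> pos i < t + \<delta>"
proof -
  have t: "0 \<le> t" "t < 1" using assms(1) by (auto simp: gap_def)
  obtain i where i: "pos i < min 1 (t + \<delta>)" "t < pos_end i"
    using intervals_dense[of t "min 1 (t + \<delta>)"] t assms(2) by auto
  then have "\<not> pos i \<le> t" using assms(1) by (auto simp: gap_def)
  then show ?thesis using i by (intro exI[of _ i]) auto
qed

text \<open>Near a gap \<open>t\<close> only vertices of large index occur, so the vertices near \<open>t\<close> lie in a
  single component of the graph minus any given finite set.\<close>

lemma gap_end:
  assumes gap: "gap t"
  shows "\<exists>\<omega>\<in>ends V E. \<forall>S C. finite S \<and> S \<subseteq> V \<and> C \<in> graph_components E (V - S) \<and> lives_in \<omega> C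
    \<longrightarrow> (\<exists>\<delta>>0. \<forall>i. \<bar>pos i - t\<bar> < \<delta> \<longrightarrow> e i \<in> C)"
proof -
  have e_V: "e i \<in> V" and e_inj: "e i = e j \<longleftrightarrow> i = j" for i j
    using bij_e by (auto simp: bij_betw_def inj_eq)
  \<comment> \<open>Distance from \<open>t\<close> to the nearest of the first \<open>n + 1\<close>
    vertices, positive because no vertex is placed at a gap.\<close>
  define D where "D n = Min ((\<lambda>i. \<bar>pos i - t\<bar>) ` {..n})" for n :: nat
  define U where "U n = {i. \<bar>pos i - t\<bar> < D n}" for n
  define X where "X n = V - e ` {..n}" for n
  have D_pos: "0 < D n" for n
    using gap_pos_neq[OF gap] by (simp add: D_def)
  have U_gt: "n < i" if "i \<in> U n" for i n
  proof (rule ccontr)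
    assume "\<not> n < i"
    then have "D n \<le> \<bar>pos i - t\<bar>" unfolding D_def by (intro Min_le) auto
    then show False using that by (simp add: U_def)
  qed
  have U_Suc: "U (Suc n) \<subseteq> U n" for n
  proof -
    have "D (Suc n) \<le> D n" unfolding D_def by (intro Min_antimono) auto
    then show ?thesis by (auto simp: U_def)
  qed
  have less_connected: "(e i, e j) \<in> reach_on E (X n)" if ij: "i \<in> U n" "j \<in> U n" "lt i j" for i j n
    unfolding X_def
  proof (rule interval_connected[OF ij(3)])
    fix s assume "s \<in> {..n}"
    then have s: "D n \<le> \<bar>pos s - t\<bar>" unfolding D_def by (intro Min_le) auto
    have "pos s < pos i \<or> pos j < pos s"
      using s ij(1,2) by (auto simp: U_def)
    then show "lt s i \<or> lt j s" by (simp add: pos_less_iff)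
  qed simp
  have connected: "(e i, e j) \<in> reach_on E (X n)" if ij: "i \<in> U n" "j \<in> U n" for i j n
  proof (cases "i = j")
    case True
    then show ?thesis
      using U_gt[OF ij(1)] e_V by (auto simp: X_def e_inj intro!: reach_on_refl)
  next
    case False
    then show ?thesis using lt_total less_connected ij reach_on_sym by metis
  qed
  have "\<exists>i. i \<in> U n" for n
  proof -
    obtain i where "t - D n < pos i" "pos i < t"
      using gap_approx_left[OF gap D_pos[of n]] by blast
    then show ?thesis by (intro exI[of _ i]) (simp add: U_def)
  qed
  then obtain a where a: "\<And>n. a n \<in> U n" by metis
  \<comment> \<open>Vertices ever closer to \<open>t\<close> are linked outside ever larger initial
    sets, and these sets exhaust \<open>V\<close>; the resulting ray represents the end.\<close>
  obtain r where r: "ray V E r" "\<And>n. \<exists>m. \<forall>k\<ge>m. (e (a n), r k) \<in> reach_on E (X n)"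
  proof (rule ray_in_decreasing_sets[of X V "\<lambda>n. e (a n)" E])
    show "X (Suc n) \<subseteq> X n" for n by (auto simp: X_def)
    show "(\<Inter>n. X n) = {}"
      using bij_e by (auto simp: X_def bij_betw_def)
    show "X 0 \<subseteq> V" by (auto simp: X_def)
    show "(e (a n), e (a (Suc n))) \<in> reach_on E (X n)" for n
      using connected a U_Suc by blast
  qed blast
  define \<omega> where "\<omega> = ray_equiv V E `` {r}"
  have \<omega>: "\<omega> \<in> ends V E" using r(1) by (auto simp: \<omega>_def ends_def intro: quotientI)
  have r_\<omega>: "r \<in> \<omega>" using equiv_class_self[OF equiv_ray_equiv] r(1) by (simp add: \<omega>_def)
  have "\<exists>\<delta>>0. \<forall>i. \<bar>pos i - t\<bar> < \<delta> \<longrightarrow> e i \<in> C"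
    if S: "finite S" "S \<subseteq> V" and C: "C \<in> graph_components E (V - S)" "lives_in \<omega> C" for S C
  proof -
    have "finite (e -` S)" using S(1) bij_e by (auto simp: bij_betw_def intro: finite_vimageI)
    then obtain n where "e -` S \<subseteq> {..n}" using finite_nat_iff_bounded_le by auto
    moreover have "S \<subseteq> e ` (e -` S)" using S(2) bij_e by (auto simp: bij_betw_def)
    ultimately have "S \<subseteq> e ` {..n}" by blast
    then have X: "X n \<subseteq> V - S" by (auto simp: X_def)
    obtain m1 where m1: "\<forall>k\<ge>m1. (e (a n), r k) \<in> reach_on E (X n)" using r(2) by blast
    obtain m2 where m2: "r ` {m2..} \<subseteq> C"
      using C(2) r_\<omega> by (auto simp: lives_in_def has_tail_in_def)
    define k where "k = max m1 m2"
    have k: "(e (a n), r k) \<in> reach_on E (X n)" "r k \<in> C" using m1 m2 by (auto simp: k_def)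
    have "e i \<in> C" if "\<bar>pos i - t\<bar> < D n" for i
    proof -
      have "(r k, e i) \<in> reach_on E (X n)"
        using reach_on_trans[OF reach_on_sym[OF k(1)] connected[OF a]] that by (simp add: U_def)
      then show ?thesis using component_closed[OF C(1) k(2)] reach_on_mono[OF X] by blast
    qed
    then show ?thesis using D_pos by blast
  qed
  then show ?thesis using \<omega> by blast
qed

end

section \<open>The Hamilton curve\<close>

lemma edge_point_0: "edge_point u v 0 = vertex_point u"
  by (auto simp: edge_point_def vertex_point_def fun_eq_iff)

lemma edge_point_eq_vertex_point_iff:
  assumes "u \<noteq> v"
  shows "edge_point u v s = vertex_point x \<longleftrightarrow> x = u \<and> s = 0 \<or> x = v \<and> s = 1"
proof
  assume "edge_point u v s = vertex_point x"
  then have "(\<lambda>z. if z = u then 1 - s else if z = v then s else 0) = (\<lambda>z. if z = x then 1 else 0)"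
    by (simp add: edge_point_def vertex_point_def)
  from fun_cong[OF this, of x] show "x = u \<and> s = 0 \<or> x = v \<and> s = 1"
    by (auto split: if_splits)
qed (use assms in \<open>auto simp: edge_point_def vertex_point_def fun_eq_iff\<close>)

lemma edge_point_eq_iff:
  assumes "u \<noteq> v" "x \<noteq> y" "0 < t" "t < 1"
  shows "edge_point u v s = edge_point x y t \<longleftrightarrow> u = x \<and> v = y \<and> s = t \<or> u = y \<and> v = x \<and> s = 1 - t"
proof
  assume "edge_point u v s = edge_point x y t"
  then have "(\<lambda>z. if z = u then 1 - s else if z = v then s else 0) =
      (\<lambda>z. if z = x then 1 - t else if z = y then t else 0)"
    by (simp add: edge_point_def)
  note eq = fun_cong[OF this]
  have "x \<in> {u, v}" using eq[of x] assms by (auto split: if_splits)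
  moreover have "y \<in> {u, v}" using eq[of y] assms by (auto split: if_splits)
  ultimately show "u = x \<and> v = y \<and> s = t \<or> u = y \<and> v = x \<and> s = 1 - t"
    using eq[of x] assms by auto
next
  assume "u = x \<and> v = y \<and> s = t \<or> u = y \<and> v = x \<and> s = 1 - t"
  then show "edge_point u v s = edge_point x y t"
    using edge_point_commute[OF assms(2), of t] by auto
qed

lemma edge_point_in_vertex_star_iff:
  assumes simple: "simple_graph V E" and uv: "{u, v} \<in> E" and s: "0 \<le> s" "s \<le> 1"
    and \<epsilon>: "0 < \<epsilon>" "\<epsilon> \<le> 1"
  shows "edge_point u v s \<in> vertex_star E x \<epsilon> \<longleftrightarrow> x = u \<and> s < \<epsilon> \<or> x = v \<and> 1 - \<epsilon> < s"
proof -
  note neq = simple_graph_edge(3)[OF simple]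
  have "edge_point u v s \<in> vertex_star E x \<epsilon> \<longleftrightarrow> edge_point u v s = vertex_point x \<or>
      (\<exists>w t. {x, w} \<in> E \<and> 0 < t \<and> t < \<epsilon> \<and> edge_point u v s = edge_point x w t)"
    by (auto simp: vertex_star_def)
  also have "\<dots> \<longleftrightarrow> (x = u \<and> s = 0 \<or> x = v \<and> s = 1) \<or>
      (\<exists>w t. {x, w} \<in> E \<and> 0 < t \<and> t < \<epsilon> \<and> (u = x \<and> v = w \<and> s = t \<or> u = w \<and> v = x \<and> s = 1 - t))"
    using edge_point_eq_iff[OF neq[OF uv] neq] \<epsilon>
    by (simp add: edge_point_eq_vertex_point_iff[OF neq[OF uv]] cong: conj_cong)
  also have "\<dots> \<longleftrightarrow> x = u \<and> s < \<epsilon> \<or> x = v \<and> 1 - \<epsilon> < s"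
  proof (intro iffI)
    assume "x = u \<and> s < \<epsilon> \<or> x = v \<and> 1 - \<epsilon> < s"
    then consider "x = u" "s = 0" | "x = v" "s = 1" | "x = u" "0 < s" "s < \<epsilon>" | "x = v" "s < 1" "1 - \<epsilon> < s"
      using s by linarith
    then show "(x = u \<and> s = 0 \<or> x = v \<and> s = 1) \<or>
      (\<exists>w t. {x, w} \<in> E \<and> 0 < t \<and> t < \<epsilon> \<and> (u = x \<and> v = w \<and> s = t \<or> u = w \<and> v = x \<and> s = 1 - t))"
    proof cases
      case 4
      then show ?thesis using uv
        by (intro disjI2 exI[of _ u] exI[of _ "1 - s"]) (auto simp: insert_commute)
    qed (use uv in auto)
  qed (use \<epsilon> in auto)
  finally show ?thesis .
qed

lemma edge_point_in_edge_interval_iff: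
  assumes simple: "simple_graph V E" and uv: "{u, v} \<in> E" and xy: "{x, y} \<in> E"
    and ab: "0 \<le> a" "b \<le> 1"
  shows "edge_point u v s \<in> edge_interval x y a b \<longleftrightarrow>
    u = x \<and> v = y \<and> a < s \<and> s < b \<or> u = y \<and> v = x \<and> a < 1 - s \<and> 1 - s < b"
proof -
  note neq = simple_graph_edge(3)[OF simple]
  have "edge_point u v s \<in> edge_interval x y a b \<longleftrightarrow>
      (\<exists>t. a < t \<and> t < b \<and> edge_point u v s = edge_point x y t)"
    by (auto simp: edge_interval_def)
  also have "\<dots> \<longleftrightarrow>
      (\<exists>t. a < t \<and> t < b \<and> (u = x \<and> v = y \<and> s = t \<or> u = y \<and> v = x \<and> s = 1 - t))"
    using edge_point_eq_iff[OF neq[OF uv] neq[OF xy]] ab by (simp cong: conj_cong)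
  also have "\<dots> \<longleftrightarrow>
      u = x \<and> v = y \<and> a < s \<and> s < b \<or> u = y \<and> v = x \<and> a < 1 - s \<and> 1 - s < b"
    by (auto intro: exI[of _ "1 - s"])
  finally show ?thesis .
qed

text \<open>An edge leaving the component \<open>C\<close> ends in \<open>S\<close>, so the full
  edges and partial edges of the definition exhaust the cases with an endpoint in
  \<open>C\<close>.\<close>

lemma edge_point_in_end_nbhd_iff:
  assumes simple: "simple_graph V E" and uv: "{u, v} \<in> E" and s: "0 \<le> s" "s \<le> 1"
    and \<epsilon>: "0 < \<epsilon>" "\<epsilon> \<le> 1" and C: "C \<in> graph_components E (V - S)"
  shows "edge_point u v s \<in> end_nbhd V E S C \<epsilon> \<longleftrightarrow>
    u \<in> C \<and> v \<in> C \<or> u \<in> C \<and> s < \<epsilon> \<or> v \<in> C \<and> 1 - \<epsilon> < s"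
proof -
  note V = simple_graph_edge(1,2)[OF simple] and neq = simple_graph_edge(3)[OF simple]
  have disj: "C \<inter> S = {}" using component_subset[OF C] by blast
  have adj: "b \<in> C \<or> b \<in> S" if "a \<in> C" "{a, b} \<in> E" for a b
  proof (rule disjCI)
    assume "b \<notin> S"
    then have "(a, b) \<in> reach_on E (V - S)"
      using that V[OF that(2)] disj by (intro reach_on_edge) auto
    then show "b \<in> C" using component_closed[OF C that(1)] by blast
  qed
  have vu: "{v, u} \<in> E" using uv by (simp add: insert_commute)
  have "edge_point u v s \<in> end_nbhd V E S C \<epsilon> \<longleftrightarrow> (\<exists>x\<in>C. edge_point u v s = vertex_point x) \<or>
      (\<exists>x y t. x \<in> C \<and> y \<in> C \<and> {x, y} \<in> E \<and> 0 < t \<and> t < 1 \<and> edge_point u v s = edge_point x y t) \<or>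
      (\<exists>x y t. x \<in> C \<and> y \<in> S \<and> {x, y} \<in> E \<and> 0 < t \<and> t < \<epsilon> \<and> edge_point u v s = edge_point x y t)"
  proof -
    have "edge_point u v s \<noteq> End \<omega>" for \<omega> by (simp add: edge_point_def)
    then show ?thesis
      unfolding end_nbhd_def Un_iff mem_Collect_eq image_iff Bex_def by blast
  qed
  also have "\<dots> \<longleftrightarrow> (\<exists>x\<in>C. x = u \<and> s = 0 \<or> x = v \<and> s = 1) \<or>
      (\<exists>x y t. x \<in> C \<and> y \<in> C \<and> {x, y} \<in> E \<and> 0 < t \<and> t < 1 \<and>
        (u = x \<and> v = y \<and> s = t \<or> u = y \<and> v = x \<and> s = 1 - t)) \<or>
      (\<exists>x y t. x \<in> C \<and> y \<in> S \<and> {x, y} \<in> E \<and> 0 < t \<and> t < \<epsilon> \<and>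
        (u = x \<and> v = y \<and> s = t \<or> u = y \<and> v = x \<and> s = 1 - t))"
    using edge_point_eq_iff[OF neq[OF uv] neq] \<epsilon>
    by (simp add: edge_point_eq_vertex_point_iff[OF neq[OF uv]] cong: conj_cong)
  also have "\<dots> \<longleftrightarrow> u \<in> C \<and> v \<in> C \<or> u \<in> C \<and> s < \<epsilon> \<or> v \<in> C \<and> 1 - \<epsilon> < s" (is "?L \<longleftrightarrow> ?R")
  proof
    assume ?L
    then show ?R using \<epsilon> by auto
  next
    assume ?R
    then consider "u \<in> C" "s = 0" | "v \<in> C" "s = 1"
      | "u \<in> C" "v \<in> C" "0 < s" "s < 1"
      | "u \<in> C" "v \<in> S" "0 < s" "s < \<epsilon>" | "v \<in> C" "u \<in> S" "s < 1" "1 - \<epsilon> < s"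
      using s adj[OF _ uv] adj[OF _ vu] by (smt (verit))
    then show ?L
    proof cases
      case 3
      then show ?thesis using uv by blast
    next
      case 4
      then show ?thesis using uv by blast
    next
      case 5
      then show ?thesis using vu
        by (intro disjI2 exI[of _ v] exI[of _ u] exI[of _ "1 - s"]) auto
    qed auto
  qed
  finally show ?thesis .
qed

lemma continuous_edge_point:
  assumes simple: "simple_graph V E" and uv: "{u, v} \<in> E"
  shows "continuous_map (top_of_set {0..1}) (freudenthal V E) (edge_point u v)"
  unfolding freudenthal_def
proof (rule continuous_on_generated_topo)
  fix B assume "B \<in> freudenthal_basis V E"
  then consider x \<epsilon> where "B = vertex_star E x \<epsilon>" "0 < \<epsilon>" "\<epsilon> \<le> 1"
    | x y a b where "B = edge_interval x y a b" "{x, y} \<in> E" "0 \<le> a" "b \<le> 1"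
    | S C \<epsilon> where "B = end_nbhd V E S C \<epsilon>" "C \<in> graph_components E (V - S)" "0 < \<epsilon>" "\<epsilon> \<le> 1"
    unfolding freudenthal_basis_def by blast
  then obtain T where T: "open T" "\<forall>s\<in>{0..1}. edge_point u v s \<in> B \<longleftrightarrow> s \<in> T"
  proof cases
    case 1
    have "open ((if x = u then {..<\<epsilon>} else {}) \<union> (if x = v then {1 - \<epsilon><..} else {}))" by auto
    then show ?thesis
      by (rule that) (use edge_point_in_vertex_star_iff[OF simple uv] 1 in auto)
  next
    case 2
    let ?T = "(if u = x \<and> v = y then {a<..<b} else {}) \<union> (if u = y \<and> v = x then {1-b<..<1-a} else {})"
    have "(P \<and> a < s \<and> s < b \<or> Q \<and> a < 1 - s \<and> 1 - s < b) \<longleftrightarrow>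
        s \<in> (if P then {a<..<b} else {}) \<union> (if Q then {1-b<..<1-a} else {})" for P Q s
      by auto
    from this[of "u = x \<and> v = y" _ "u = y \<and> v = x"]
    have "edge_point u v s \<in> B \<longleftrightarrow> s \<in> ?T" for s
      unfolding 2(1) edge_point_in_edge_interval_iff[OF simple uv 2(2-4)] by (simp only: conj_assoc)
    moreover have "open ?T" by (intro open_Un) simp_all
    ultimately show ?thesis using that by blast
  next
    case 3
    have "open ((if u \<in> C \<and> v \<in> C then UNIV else {}) \<union> (if u \<in> C then {..<\<epsilon>} else {}) \<union>
        (if v \<in> C then {1 - \<epsilon><..} else {}))" by auto
    then show ?thesis
      by (rule that) (use edge_point_in_end_nbhd_iff[OF simple uv _ _ 3(3,4,2)] 3(1) in auto)
  qed
  have "edge_point u v -` B \<inter> {0..1} = {0..1} \<inter> T" using T(2) by auto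
  then show "openin (top_of_set {0..1}) (edge_point u v -` B \<inter> topspace (top_of_set {0..1}))"
    using T(1) by (simp add: openin_open_Int)
next
  have "edge_point u v s \<in> freudenthal_points V E" if s: "0 \<le> s" "s \<le> 1" for s
  proof -
    note V = simple_graph_edge(1,2)[OF simple uv] and neq = simple_graph_edge(3)[OF simple uv]
    consider "s = 0" | "s = 1" | "0 < s" "s < 1" using s by linarith
    then show ?thesis
    proof cases
      case 1
      then show ?thesis using V by (simp add: freudenthal_points_def edge_point_0)
    next
      case 2
      then have "edge_point u v s = vertex_point v" using edge_point_eq_vertex_point_iff[OF neq] by simp
      then show ?thesis using V by (simp add: freudenthal_points_def)
    next
      case 3
      then show ?thesis using uv unfolding freudenthal_points_def by blast
    qed
  qed
  then show "edge_point u v ` topspace (top_of_set {0..1}) \<subseteq> \<Union> (freudenthal_basis V E)"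
    using topspace_freudenthal[OF simple] by (auto simp: freudenthal_def)
qed

context vertex_order
begin

section \<open>Parametrizing the curve over the unit interval\<close>

definition next_vertex :: "nat \<Rightarrow> nat" where
  "next_vertex i = (SOME j. {e i, e j} \<in> E \<and> follows lt i j)"

definition gap_limit :: "real \<Rightarrow> (nat \<Rightarrow> 'a) set" where
  "gap_limit t = (SOME \<omega>. \<omega> \<in> ends V E \<and>
    (\<forall>S C. finite S \<and> S \<subseteq> V \<and> C \<in> graph_components E (V - S) \<and> lives_in \<omega> C
      \<longrightarrow> (\<exists>\<delta>>0. \<forall>i. \<bar>pos i - t\<bar> < \<delta> \<longrightarrow> e i \<in> C)))"

text \<open>A vertex sits at the left end of its interval, and the rest is run linearly along the
  edge to the next vertex. The value at 1 closes the curve, as \<open>pos 0 = 0\<close>.\<close>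

definition curve :: "real \<Rightarrow> 'a fpoint" where
  "curve t = (if 1 \<le> t then vertex_point (e 0)
    else if gap t then End (gap_limit t)
    else let i = THE i. pos i \<le> t \<and> t < pos_end i
      in edge_point (e i) (e (next_vertex i)) ((t - pos i) / weight i))"

lemma next_vertex: "{e i, e (next_vertex i)} \<in> E" "follows lt i (next_vertex i)"
  using someI_ex[OF succ_exists[of i]] by (auto simp: next_vertex_def)

lemma gap_limit:
  assumes "gap t"
  shows "gap_limit t \<in> ends V E"
    "finite S \<Longrightarrow> S \<subseteq> V \<Longrightarrow> C \<in> graph_components E (V - S) \<Longrightarrow> lives_in (gap_limit t) C \<Longrightarrow>
      \<exists>\<delta>>0. \<forall>i. \<bar>pos i - t\<bar> < \<delta> \<longrightarrow> e i \<in> C"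
proof -
  have "gap_limit t \<in> ends V E \<and>
    (\<forall>S C. finite S \<and> S \<subseteq> V \<and> C \<in> graph_components E (V - S) \<and> lives_in (gap_limit t) C
      \<longrightarrow> (\<exists>\<delta>>0. \<forall>i. \<bar>pos i - t\<bar> < \<delta> \<longrightarrow> e i \<in> C))"
    unfolding gap_limit_def by (rule someI_ex) (use gap_end[OF assms] in blast)
  then show "gap_limit t \<in> ends V E"
    "finite S \<Longrightarrow> S \<subseteq> V \<Longrightarrow> C \<in> graph_components E (V - S) \<Longrightarrow> lives_in (gap_limit t) C \<Longrightarrow>
      \<exists>\<delta>>0. \<forall>i. \<bar>pos i - t\<bar> < \<delta> \<longrightarrow> e i \<in> C" by blast+
qed

lemma curve_at_interval:
  assumes "pos i \<le> t" "t < pos_end i"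
  shows "curve t = edge_point (e i) (e (next_vertex i)) ((t - pos i) / weight i)"
proof -
  have "(THE i. pos i \<le> t \<and> t < pos_end i) = i"
    using assms intervals_disjoint by (intro the_equality) blast+
  moreover have "\<not> gap t" using assms by (auto simp: gap_def)
  moreover have "\<not> 1 \<le> t" using assms pos_end_le_1[of i] by simp
  ultimately show ?thesis by (simp add: curve_def)
qed

lemma curve_at_pos: "curve (pos i) = vertex_point (e i)"
  using curve_at_interval[of i "pos i"] pos_less_pos_end by (simp add: edge_point_0)

text \<open>At the right end the edge formula yields the next vertex, which starts the adjacent
  interval or is the closing value at 1. This supplies continuity from the left at vertices.\<close>

lemma curve_at_closed_interval:
  assumes "pos i \<le> t" "t \<le> pos_end i"
  shows "curve t = edge_point (e i) (e (next_vertex i)) ((t - pos i) / weight i)"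
proof (cases "t < pos_end i")
  case False
  then have t: "t = pos_end i" using assms by simp
  have "e i \<noteq> e (next_vertex i)" using simple_graph_edge(3)[OF simple next_vertex(1)] .
  then have "edge_point (e i) (e (next_vertex i)) ((t - pos i) / weight i) =
      vertex_point (e (next_vertex i))"
    using weight_pos[of i] by (simp add: edge_point_eq_vertex_point_iff t pos_end_def)
  moreover have "curve t = vertex_point (e (next_vertex i))"
    using follows_pos[OF next_vertex(2)[of i]]
  proof (elim disjE conjE)
    assume "pos (next_vertex i) = pos_end i"
    then show ?thesis using curve_at_pos[of "next_vertex i"] t by simp
  qed (simp add: curve_def t)
  ultimately show ?thesis by simp
qed (use curve_at_interval assms in blast)

lemma curve_continuous_on_interval:
  "continuous_map (top_of_set {pos i..pos_end i}) (freudenthal V E) curve"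
proof (rule continuous_map_eq)
  show "continuous_map (top_of_set {pos i..pos_end i}) (freudenthal V E)
      (edge_point (e i) (e (next_vertex i)) \<circ> (\<lambda>t. (t - pos i) / weight i))"
  proof (rule continuous_map_compose[OF _ continuous_edge_point[OF simple next_vertex(1)]])
    have "continuous_on {pos i..pos_end i} (\<lambda>t. (t - pos i) / weight i)"
      using weight_pos[of i] by (intro continuous_intros) auto
    moreover have "(t - pos i) / weight i \<in> {0..1}" if "t \<in> {pos i..pos_end i}" for t
      using that weight_pos[of i] by (auto simp: pos_end_def)
    ultimately show "continuous_map (top_of_set {pos i..pos_end i}) (top_of_set {0..1})
        (\<lambda>t. (t - pos i) / weight i)"
      by (auto simp: continuous_map_in_subtopology)
  qed
qed (auto simp: curve_at_closed_interval[of i])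

lemma curve_stays_on_interval:
  assumes "B \<in> freudenthal_basis V E" "curve t \<in> B" "t \<in> {pos i..pos_end i}"
  shows "\<exists>\<delta>>0. \<forall>t'\<in>{pos i..pos_end i}. \<bar>t' - t\<bar> < \<delta> \<longrightarrow> curve t' \<in> B"
proof -
  have "openin (freudenthal V E) B"
    unfolding freudenthal_def by (rule topology_generated_by_Basis[OF assms(1)])
  then have "openin (top_of_set {pos i..pos_end i}) {x \<in> topspace (top_of_set {pos i..pos_end i}). curve x \<in> B}"
    by (rule openin_continuous_map_preimage[OF curve_continuous_on_interval])
  then show ?thesis
    using assms(2,3) unfolding openin_euclidean_subtopology_iff by (auto simp: dist_real_def)
qed

text \<open>Cutting off at the positions of two vertices \<open>a\<close> and \<open>b\<close>
  around \<open>t\<close> avoids partial edges: all vertices placed between them lie in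
  \<open>C\<close>, so the edges run there lie in \<open>C\<close> and the ends met there live in
  \<open>C\<close>.\<close>

lemma curve_stays_at_gap:
  assumes B: "B \<in> freudenthal_basis V E" "curve t \<in> B" and gap: "gap t"
  shows "\<exists>\<delta>>0. \<forall>t'\<in>{0..1}. \<bar>t' - t\<bar> < \<delta> \<longrightarrow> curve t' \<in> B"
proof -
  have t: "t < 1" using gap by (simp add: gap_def)
  have End: "End (gap_limit t) \<in> B" using B(2) gap t by (simp add: curve_def)
  obtain S C \<epsilon> where BSC: "B = end_nbhd V E S C \<epsilon>" and S: "finite S" "S \<subseteq> V"
    and C: "C \<in> graph_components E (V - S)"
    using B(1) End unfolding freudenthal_basis_def
    by (auto simp: vertex_star_def edge_interval_def vertex_point_def edge_point_def)
  have "lives_in (gap_limit t) C"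
    using End unfolding BSC by (auto simp: end_nbhd_def vertex_point_def edge_point_def)
  then obtain \<delta> where \<delta>: "0 < \<delta>" "\<And>i. \<bar>pos i - t\<bar> < \<delta> \<Longrightarrow> e i \<in> C"
    using gap_limit(2)[OF gap S C] by blast
  obtain a where a: "t - \<delta> < pos a" "pos a < t" using gap_approx_left[OF gap \<delta>(1)] by blast
  obtain b where b: "t < pos b" "pos b < t + \<delta>" using gap_approx_right[OF gap \<delta>(1)] by blast
  have in_C: "e i \<in> C" if "pos a \<le> pos i" "pos i \<le> pos b" for i
    using \<delta>(2)[of i] that a b by auto
  have "curve t' \<in> B" if t': "pos a < t'" "t' < pos b" for t'
  proof -
    have "t' < 1" using t'(2) pos_less_pos_end[of b] pos_end_le_1[of b] by simp
    show ?thesis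
    proof (cases "gap t'")
      case True
      \<comment> \<open>Vertices close to the second gap lie both in its component \<open>D\<close>
        and in \<open>C\<close>, so the components agree.\<close>
      obtain D where D: "D \<in> graph_components E (V - S)" "lives_in (gap_limit t') D"
        using end_lives_in_component[OF gap_limit(1)[OF True] S] by blast
      then obtain \<delta>' where \<delta>': "0 < \<delta>'" "\<And>i. \<bar>pos i - t'\<bar> < \<delta>' \<Longrightarrow> e i \<in> D"
        using gap_limit(2)[OF True S] by blast
      obtain i where i: "t' - min \<delta>' (t' - pos a) < pos i" "pos i < t'"
        using gap_approx_left[OF True, of "min \<delta>' (t' - pos a)"] \<delta>'(1) t'(1) by auto
      have "e i \<in> D" using \<delta>'(2)[of i] i by auto
      moreover have "e i \<in> C" using in_C[of i] i t' by auto
      ultimately have "D = C" using component_unique[OF D(1) C] by blast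
      then show ?thesis
        using D(2) gap_limit(1)[OF True] True \<open>t' < 1\<close> by (simp add: curve_def BSC end_nbhd_def)
    next
      case False
      then obtain i where i: "pos i \<le> t'" "t' < pos_end i"
        using t' \<open>t' < 1\<close> pos_nonneg[of a] by (auto simp: gap_def)
      have "\<not> lt i a" using pos_end_le_pos[of i a] i t' by auto
      then have ai: "pos a \<le> pos i" by (simp flip: pos_less_iff)
      have "lt i b" using i t' by (simp flip: pos_less_iff)
      then have ib: "pos_end i \<le> pos b" by (rule pos_end_le_pos)
      then have "pos_end i \<noteq> 1"
        using pos_less_pos_end[of b] pos_end_le_1[of b] by simp
      then have "pos (next_vertex i) = pos_end i"
        using follows_pos[OF next_vertex(2)[of i]] by simp
      then have C': "e i \<in> C" "e (next_vertex i) \<in> C"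
        using in_C[of i] in_C[of "next_vertex i"] ai ib pos_less_pos_end[of i] by auto
      define s where "s = (t' - pos i) / weight i"
      have s: "0 \<le> s" "s < 1"
        using i weight_pos[of i] by (auto simp: s_def pos_end_def)
      have curve: "curve t' = edge_point (e i) (e (next_vertex i)) s"
        using curve_at_interval[OF i] by (simp add: s_def)
      show ?thesis
      proof (cases "s = 0")
        case True
        then show ?thesis using curve C' by (simp add: BSC end_nbhd_def edge_point_0)
      next
        case False
        then show ?thesis
          using curve C' s next_vertex(1)[of i] unfolding BSC end_nbhd_def by force
      qed
    qed
  qed
  then show ?thesis
    using a b by (intro exI[of _ "min (t - pos a) (pos b - t)"]) auto
qed

lemma curve_continuous: "continuous_map (top_of_set {0..1}) (freudenthal V E) curve"
  unfolding freudenthal_def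
proof (rule continuous_on_generated_topo)
  fix B assume B: "B \<in> freudenthal_basis V E"
  have "\<exists>\<delta>>0. \<forall>t'\<in>{0..1}. \<bar>t' - t\<bar> < \<delta> \<longrightarrow> curve t' \<in> B"
    if t: "0 \<le> t" "t \<le> 1" and tB: "curve t \<in> B" for t
  proof (cases "gap t")
    case True
    then show ?thesis using curve_stays_at_gap[OF B tB] by blast
  next
    case False
    have right: "\<exists>\<delta>>0. \<forall>t'\<in>{0..1}. t \<le> t' \<and> t' < t + \<delta> \<longrightarrow> curve t' \<in> B"
    proof (cases "t = 1")
      case True
      have "curve t' \<in> B" if "t' \<in> {0..1}" "t \<le> t'" for t'
      proof -
        have "t' = t" using that True by simp
        then show ?thesis using tB by simp
      qed
      then show ?thesis by (intro exI[of _ 1]) auto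
    next
      case False
      then obtain i where i: "pos i \<le> t" "t < pos_end i"
        using \<open>\<not> gap t\<close> t by (auto simp: gap_def)
      obtain \<delta> where "0 < \<delta>" "\<forall>t'\<in>{pos i..pos_end i}. \<bar>t' - t\<bar> < \<delta> \<longrightarrow> curve t' \<in> B"
        using curve_stays_on_interval[OF B tB, of i] i by auto
      then show ?thesis using i by (intro exI[of _ "min \<delta> (pos_end i - t)"]) auto
    qed
    have left: "\<exists>\<delta>>0. \<forall>t'\<in>{0..1}. t - \<delta> < t' \<and> t' \<le> t \<longrightarrow> curve t' \<in> B"
    proof (cases "t = 0")
      case True
      have "curve t' \<in> B" if "t' \<in> {0..1}" "t' \<le> t" for t'
      proof -
        have "t' = t" using that True by simp
        then show ?thesis using tB by simp
      qed
      then show ?thesis by (intro exI[of _ 1]) auto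
    next
      case False
      \<comment> \<open>To the left of \<open>t\<close> the relevant interval may be the preceding
        one: at a vertex that of its predecessor, at 1 that of the vertex before index 0.\<close>
      obtain i where i: "pos i < t" "t \<le> pos_end i"
      proof (cases "t = 1")
        case True
        obtain i where "follows lt i 0" using pred_exists by blast
        then have "pos_end i = 1" using follows_pos by blast
        then show thesis using that[of i] True pos_less_pos_end[of i] by simp
      next
        case t1: False
        then obtain i where i: "pos i \<le> t" "t < pos_end i"
          using \<open>\<not> gap t\<close> t by (auto simp: gap_def)
        show thesis
        proof (cases "pos i = t")
          case True
          obtain j where "follows lt j i" using pred_exists by blast
          moreover have "i \<noteq> 0" using True False pos_zero by metis
          ultimately have "pos_end j = t" using follows_pos[of j i] True by simp
          then show thesis using that[of j] pos_less_pos_end[of j] by simp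
        qed (use i that[of i] in auto)
      qed
      obtain \<delta> where "0 < \<delta>" "\<forall>t'\<in>{pos i..pos_end i}. \<bar>t' - t\<bar> < \<delta> \<longrightarrow> curve t' \<in> B"
        using curve_stays_on_interval[OF B tB, of i] i by auto
      then show ?thesis using i by (intro exI[of _ "min \<delta> (t - pos i)"]) auto
    qed
    obtain \<delta>1 \<delta>2 where \<delta>: "0 < \<delta>1" "0 < \<delta>2"
      "\<forall>t'\<in>{0..1}. t \<le> t' \<and> t' < t + \<delta>1 \<longrightarrow> curve t' \<in> B"
      "\<forall>t'\<in>{0..1}. t - \<delta>2 < t' \<and> t' \<le> t \<longrightarrow> curve t' \<in> B"
      using left right by blast
    have "curve t' \<in> B" if "t' \<in> {0..1}" "\<bar>t' - t\<bar> < min \<delta>1 \<delta>2" for t'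
    proof (cases "t \<le> t'")
      case True
      then show ?thesis using \<delta>(3) that by (auto simp: abs_less_iff)
    next
      case False
      then show ?thesis using \<delta>(4) that by (auto simp: abs_less_iff)
    qed
    then show ?thesis using \<delta>(1,2) by (intro exI[of _ "min \<delta>1 \<delta>2"]) simp
  qed
  then show "openin (top_of_set {0..1}) (curve -` B \<inter> topspace (top_of_set {0..1}))"
    by (auto simp: openin_euclidean_subtopology_iff dist_real_def)
next
  have "curve t \<in> topspace (freudenthal V E)" if t: "0 \<le> t" "t \<le> 1" for t
  proof -
    have e_V: "e i \<in> V" for i using bij_e by (auto simp: bij_betw_def)
    consider "t = 1" | "t < 1" "gap t" | i where "pos i \<le> t" "t < pos_end i"
      using t unfolding gap_def by force
    then show ?thesis
    proof cases
      case 1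
      then show ?thesis
        using e_V by (simp add: curve_def topspace_freudenthal[OF simple] freudenthal_points_def)
    next
      case 2
      then show ?thesis using gap_limit(1)
        by (simp add: curve_def topspace_freudenthal[OF simple] freudenthal_points_def)
    next
      case 3
      then show ?thesis
        using continuous_map_image_subset_topspace[OF curve_continuous_on_interval[of i]] by force
    qed
  qed
  then show "curve ` topspace (top_of_set {0..1}) \<subseteq> \<Union> (freudenthal_basis V E)"
    by (auto simp: freudenthal_def)
qed

text \<open>On a half-open interval the edge parameter never reaches 1, so only the initial vertex
  of the edge is met there.\<close>

lemma curve_eq_vertex_point:
  assumes "0 \<le> t" "t < 1" "curve t = vertex_point (e i)"
  shows "t = pos i"
proof -
  have "\<not> gap t" using assms by (auto simp: curve_def vertex_point_def)
  then obtain j where j: "pos j \<le> t" "t < pos_end j" using assms(1,2) by (auto simp: gap_def)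
  have "e j \<noteq> e (next_vertex j)" using simple_graph_edge(3)[OF simple next_vertex(1)] .
  moreover have "(t - pos j) / weight j \<noteq> 1"
    using j weight_pos[of j] by (auto simp: pos_end_def)
  ultimately have "e i = e j" "(t - pos j) / weight j = 0"
    using assms(3) curve_at_interval[OF j] edge_point_eq_vertex_point_iff by metis+
  then show ?thesis
    using bij_e weight_pos[of j] by (auto simp: bij_betw_def inj_eq)
qed

theorem hamilton_curve_exists: "\<exists>f. hamilton_curve V E f"
proof -
  define wrap :: "real \<Rightarrow> complex" where "wrap t = exp (\<i> * of_real (2 * pi * t))" for t
  define unwrap :: "complex \<Rightarrow> real" where "unwrap z = Arg2pi z / (2 * pi)" for z
  have unwrap_range: "0 \<le> unwrap z" "unwrap z < 1" for z
    using Arg2pi_ge_0[of z] Arg2pi_lt_2pi[of z] by (auto simp: unwrap_def)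
  have wrap_unwrap: "wrap (unwrap z) = z" if "z \<in> sphere 0 1" for z
    using that complex_norm_eq_1_exp[of z] by (simp add: wrap_def unwrap_def)
  have unwrap_wrap: "unwrap (wrap t) = t" if "0 \<le> t" "t < 1" for t
  proof -
    have "Arg2pi (wrap t) = 2 * pi * t"
      using that by (intro Arg2pi_unique[of 1]) (auto simp: wrap_def)
    then show ?thesis by (simp add: unwrap_def)
  qed
  have wrap_sphere: "wrap t \<in> sphere 0 1" for t
    by (simp add: wrap_def norm_exp_i_times)
  have wrap_1: "wrap 1 = wrap 0"
    by (simp add: wrap_def mult.commute)
  have wrap_cont: "continuous_on {0..1} wrap"
    unfolding wrap_def by (intro continuous_intros)
  \<comment> \<open>Since \<open>unwrap\<close> jumps at the base point, continuity is obtained by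
    factoring \<open>curve\<close> through this quotient map, closed as a continuous map from a
    compact to a Hausdorff space.\<close>
  have "quotient_map (top_of_set {0..1}) (top_of_set (sphere 0 1)) wrap"
  proof (rule continuous_closed_imp_quotient_map)
    show cont: "continuous_map (top_of_set {0..1}) (top_of_set (sphere 0 1)) wrap"
      using wrap_cont wrap_sphere by (auto simp: continuous_map_in_subtopology)
    show "closed_map (top_of_set {0..1}) (top_of_set (sphere 0 1)) wrap"
      using cont by (intro continuous_imp_closed_map) (auto simp: compact_space_subtopology Hausdorff_space_subtopology)
    show "wrap ` topspace (top_of_set {0..1}) = topspace (top_of_set (sphere 0 1))"
    proof
      show "topspace (top_of_set (sphere 0 1)) \<subseteq> wrap ` topspace (top_of_set {0..1})"
      proof
        fix z :: complex assume "z \<in> topspace (top_of_set (sphere 0 1))"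
        then have "z = wrap (unwrap z)" using wrap_unwrap by simp
        then show "z \<in> wrap ` topspace (top_of_set {0..1})"
          using unwrap_range[of z] by (intro image_eqI[of _ _ "unwrap z"]) auto
      qed
    qed (use wrap_sphere in auto)
  qed
  moreover have "continuous_map (top_of_set {0..1}) (freudenthal V E) ((curve \<circ> unwrap) \<circ> wrap)"
  proof (rule continuous_map_eq[OF curve_continuous])
    fix t assume "t \<in> topspace (top_of_set {0..1::real})"
    then have t: "0 \<le> t" "t \<le> 1" by auto
    show "curve t = ((curve \<circ> unwrap) \<circ> wrap) t"
    proof (cases "t = 1")
      case True
      then show ?thesis
        using wrap_1 unwrap_wrap[of 0] curve_at_pos[of 0] by (simp add: curve_def pos_zero)
    qed (use t unwrap_wrap in simp)
  qed
  ultimately have "continuous_map (top_of_set (sphere 0 1)) (freudenthal V E) (curve \<circ> unwrap)"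
    by (rule continuous_compose_quotient_map)
  moreover have "\<exists>!z. z \<in> sphere 0 1 \<and> (curve \<circ> unwrap) z = vertex_point v" if v: "v \<in> V" for v
  proof -
    obtain i where i: "v = e i" using v bij_e by (auto simp: bij_betw_def)
    have "pos i < 1" using pos_less_pos_end[of i] pos_end_le_1[of i] by simp
    show ?thesis
    proof (rule ex1I)
      show "wrap (pos i) \<in> sphere 0 1 \<and> (curve \<circ> unwrap) (wrap (pos i)) = vertex_point v"
        using wrap_sphere unwrap_wrap[OF pos_nonneg \<open>pos i < 1\<close>] curve_at_pos i by simp
      fix z :: complex assume z: "z \<in> sphere 0 1 \<and> (curve \<circ> unwrap) z = vertex_point v"
      then have "unwrap z = pos i"
        using curve_eq_vertex_point[OF unwrap_range] i by simp
      then show "z = wrap (pos i)" using wrap_unwrap z by metis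
    qed
  qed
  ultimately show ?thesis unfolding hamilton_curve_def by blast
qed

end

theorem theorem10:
  fixes V :: "'a set" and E :: "'a set set"
  assumes "simple_graph V E"
    and "connected_graph V E"
    and "infinite V"
    and "locally_finite_graph V E"
    and "L1_graph V E"
    and "\<And>u v. u \<in> V \<Longrightarrow> v \<in> V \<Longrightarrow> gdist V E u v = 2 \<Longrightarrow> card (nbhd E u \<inter> nbhd E v) \<ge> 2"
  shows "\<exists>f. hamilton_curve V E f"
proof -
  interpret two_joint_L1_graph V E
    using assms by unfold_locales
  obtain e lt where "vertex_order V E e lt"
    using vertex_order_of_cycles[OF assms(1-4) cycle_through_finite_set] by blast
  then interpret vertex_order V E e lt .
  show ?thesis by (rule hamilton_curve_exists)
qed

end
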